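(* Let $(R,P_\Omega)$ be a multiple Rota-Baxter algebra of pair weight $(\lambda_\Omega,\lambda_\Omega)$. Every projective left $(R,P_\Omega)$-module is flat.
   Context: $\mathbf{k}$ is a commutative unital ring; algebras are associative unital $\mathbf{k}$-algebras, modules are unital, "linear" means $\mathbf{k}$-linear. $\Omega$ is a nonempty set and $\lambda_\Omega=(\lambda_\omega)_{\omega\in\Omega}$ a family of elements of $\mathbf{k}$. A multiple Rota-Baxter algebra $(R,P_\Omega)$ of pair weight $(\lambda_\Omega,\lambda_\Omega)$ is an algebra $R$ with linear operators $P_\omega:R\to R$ ($\omega\in\Omega$) such that $P_\alpha(r)P_\beta(s)=P_\alpha(rP_\beta(s))+P_\beta(P_\alpha(r)s)+\lambda_\beta P_\alpha(rs)+\lambda_\alpha P_\beta(rs)$ for all $r,s\in R$, $\alpha,\beta\in\Omega$. A left $(R,P_\Omega)$-module $(M,\mathfrak{m}_\Omega)$ is a left $R$-module $M$ with linear operators $\mathfrak{m}_\omega:M\to M$ such that $P_\alpha(r)\mathfrak{m}_\beta(m)=\mathfrak{m}_\alpha(r\mathfrak{m}_\beta(m))+\mathfrak{m}_\beta(P_\alpha(r)m)+\lambda_\beta\mathfrak{m}_\alpha(rm)+\lambda_\alpha\mathfrak{m}_\beta(rm)$ for all $r\in R,m\in M,\alpha,\beta\in\Omega$. A right $(R,P_\Omega)$-module $(S,\mathfrak{s}_\Omega)$ is a right $R$-module $S$ with linear operators $\mathfrak{s}_\omega:S\to S$ such that $\mathfrak{s}_\beta(sP_\alpha(r))=\mathfrak{s}_\beta(\mathfrak{s}_\alpha(s)r)+\mathfrak{s}_\beta(s)P_\alpha(r)+\lambda_\beta\mathfrak{s}_\alpha(s)r+\lambda_\alpha\mathfrak{s}_\beta(s)r$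 for all $r\in R,s\in S,\alpha,\beta\in\Omega$. Homomorphisms of left (right) $(R,P_\Omega)$-modules are left (right) $R$-module homomorphisms commuting with the operators indexed by each $\omega\in\Omega$; epimorphism means surjective homomorphism. A left $(R,P_\Omega)$-module $S$ is projective if for every left $(R,P_\Omega)$-module epimorphism $\theta:M\to N$ and every left $(R,P_\Omega)$-module homomorphism $\varphi:S\to N$ there is a left $(R,P_\Omega)$-module homomorphism $\overline\varphi:S\to M$ with $\varphi=\theta\circ\overline\varphi$. For a right $(R,P_\Omega)$-module $(S,\mathfrak{s}_\Omega)$ and a left one $(M,\mathfrak{m}_\Omega)$, $S\otimes_{(R,P_\Omega)}M$ is the abelian group generated by symbols $s\otimes m$ ($s\in S,m\in M$) subject to additivity in each variable, $sr\otimes m=s\otimes rm$ and $\mathfrak{s}_\omega(s)\otimes m=s\otimes\mathfrak{m}_\omega(m)$ for all $r\in R,\omega\in\Omega$. A left $(R,P_\Omega)$-module $M$ is flat if the functor $-\otimes_{(R,P_\Omega)}M$ from right $(R,P_\Omega)$-modules to abelian groups is exact (takes short exact sequences to short exact sequences). *)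

theory Defs
  imports "HOL-Algebra.Algebra"
begin

section \<open>Multiple Rota-Baxter algebras and their modules\<close>

text \<open>The locale \<^locale>\<open>algebra\<close> of the library is about commutative algebras only.\<close>

locale assoc_algebra = module K R + ring R
  for K :: "('k, 'x) ring_scheme" (structure) and R :: "('k, 'r, 'y) module_scheme" (structure) +
  assumes smult_mult_left:
      "\<lbrakk>c \<in> carrier K; x \<in> carrier R; y \<in> carrier R\<rbrakk> \<Longrightarrow>
        (c \<odot>\<^bsub>R\<^esub> x) \<otimes>\<^bsub>R\<^esub> y = c \<odot>\<^bsub>R\<^esub> (x \<otimes>\<^bsub>R\<^esub> y)"
    and smult_mult_right:
      "\<lbrakk>c \<in> carrier K; x \<in> carrier R; y \<in> carrier R\<rbrakk> \<Longrightarrow>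
        x \<otimes>\<^bsub>R\<^esub> (c \<odot>\<^bsub>R\<^esub> y) = c \<odot>\<^bsub>R\<^esub> (x \<otimes>\<^bsub>R\<^esub> y)"

locale mrb_algebra = assoc_algebra K R
  for K :: "('k, 'x) ring_scheme" (structure) and R :: "('k, 'r, 'y) module_scheme" (structure) +
  fixes \<Omega> :: "'w set" and lam :: "'w \<Rightarrow> 'k" and P :: "'w \<Rightarrow> 'r \<Rightarrow> 'r"
  assumes index_nonempty: "\<Omega> \<noteq> {}"
    and weight_closed: "\<alpha> \<in> \<Omega> \<Longrightarrow> lam \<alpha> \<in> carrier K"
    and P_closed: "\<lbrakk>\<alpha> \<in> \<Omega>; x \<in> carrier R\<rbrakk> \<Longrightarrow> P \<alpha> x \<in> carrier R"
    and P_add: "\<lbrakk>\<alpha> \<in> \<Omega>; x \<in> carrier R; y \<in> carrier R\<rbrakk> \<Longrightarrow>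
        P \<alpha> (x \<oplus>\<^bsub>R\<^esub> y) = P \<alpha> x \<oplus>\<^bsub>R\<^esub> P \<alpha> y"
    and P_smult: "\<lbrakk>\<alpha> \<in> \<Omega>; c \<in> carrier K; x \<in> carrier R\<rbrakk> \<Longrightarrow>
        P \<alpha> (c \<odot>\<^bsub>R\<^esub> x) = c \<odot>\<^bsub>R\<^esub> P \<alpha> x"
    and P_rota_baxter: "\<lbrakk>\<alpha> \<in> \<Omega>; \<beta> \<in> \<Omega>; r \<in> carrier R; s \<in> carrier R\<rbrakk> \<Longrightarrow>
        P \<alpha> r \<otimes>\<^bsub>R\<^esub> P \<beta> s =
          P \<alpha> (r \<otimes>\<^bsub>R\<^esub> P \<beta> s) \<oplus>\<^bsub>R\<^esub> P \<beta> (P \<alpha> r \<otimes>\<^bsub>R\<^esub> s)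
          \<oplus>\<^bsub>R\<^esub> lam \<beta> \<odot>\<^bsub>R\<^esub> P \<alpha> (r \<otimes>\<^bsub>R\<^esub> s) \<oplus>\<^bsub>R\<^esub> lam \<alpha> \<odot>\<^bsub>R\<^esub> P \<beta> (r \<otimes>\<^bsub>R\<^esub> s)"

text \<open>The library's locale \<^locale>\<open>module\<close> requires a commutative ring of scalars. As there, the fields
  for multiplication and one of a record that represents a module are irrelevant.\<close>

locale left_module = R?: ring R + M?: abelian_group M
  for R :: "('r, 'x) ring_scheme" (structure) and M :: "('r, 'm, 'z) module_scheme" (structure) +
  assumes lact_closed: "\<lbrakk>a \<in> carrier R; x \<in> carrier M\<rbrakk> \<Longrightarrow> a \<odot>\<^bsub>M\<^esub> x \<in> carrier M"
    and lact_l_distr: "\<lbrakk>a \<in> carrier R; b \<in> carrier R; x \<in> carrier M\<rbrakk> \<Longrightarrow>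
        (a \<oplus>\<^bsub>R\<^esub> b) \<odot>\<^bsub>M\<^esub> x = a \<odot>\<^bsub>M\<^esub> x \<oplus>\<^bsub>M\<^esub> b \<odot>\<^bsub>M\<^esub> x"
    and lact_r_distr: "\<lbrakk>a \<in> carrier R; x \<in> carrier M; y \<in> carrier M\<rbrakk> \<Longrightarrow>
        a \<odot>\<^bsub>M\<^esub> (x \<oplus>\<^bsub>M\<^esub> y) = a \<odot>\<^bsub>M\<^esub> x \<oplus>\<^bsub>M\<^esub> a \<odot>\<^bsub>M\<^esub> y"
    and lact_assoc: "\<lbrakk>a \<in> carrier R; b \<in> carrier R; x \<in> carrier M\<rbrakk> \<Longrightarrow>
        (a \<otimes>\<^bsub>R\<^esub> b) \<odot>\<^bsub>M\<^esub> x = a \<odot>\<^bsub>M\<^esub> (b \<odot>\<^bsub>M\<^esub> x)"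
    and lact_one: "x \<in> carrier M \<Longrightarrow> \<one>\<^bsub>R\<^esub> \<odot>\<^bsub>M\<^esub> x = x"

record ('r, 's) rmodule = "'s ring" +
  ract :: "['s, 'r] \<Rightarrow> 's" (infixl \<open>\<oslash>\<index>\<close> 70)

locale right_module = R?: ring R + S?: abelian_group S
  for R :: "('r, 'x) ring_scheme" (structure) and S :: "('r, 's, 'z) rmodule_scheme" (structure) +
  assumes ract_closed: "\<lbrakk>a \<in> carrier R; x \<in> carrier S\<rbrakk> \<Longrightarrow> x \<oslash>\<^bsub>S\<^esub> a \<in> carrier S"
    and ract_l_distr: "\<lbrakk>a \<in> carrier R; x \<in> carrier S; y \<in> carrier S\<rbrakk> \<Longrightarrow>
        (x \<oplus>\<^bsub>S\<^esub> y) \<oslash>\<^bsub>S\<^esub> a = x \<oslash>\<^bsub>S\<^esub> a \<oplus>\<^bsub>S\<^esub> y \<oslash>\<^bsub>S\<^esub> a"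
    and ract_r_distr: "\<lbrakk>a \<in> carrier R; b \<in> carrier R; x \<in> carrier S\<rbrakk> \<Longrightarrow>
        x \<oslash>\<^bsub>S\<^esub> (a \<oplus>\<^bsub>R\<^esub> b) = x \<oslash>\<^bsub>S\<^esub> a \<oplus>\<^bsub>S\<^esub> x \<oslash>\<^bsub>S\<^esub> b"
    and ract_assoc: "\<lbrakk>a \<in> carrier R; b \<in> carrier R; x \<in> carrier S\<rbrakk> \<Longrightarrow>
        x \<oslash>\<^bsub>S\<^esub> (a \<otimes>\<^bsub>R\<^esub> b) = (x \<oslash>\<^bsub>S\<^esub> a) \<oslash>\<^bsub>S\<^esub> b"
    and ract_one: "x \<in> carrier S \<Longrightarrow> x \<oslash>\<^bsub>S\<^esub> \<one>\<^bsub>R\<^esub> = x"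

text \<open>A module over a unital \<open>K\<close>-algebra \<open>R\<close> is a \<open>K\<close>-module through \<open>c \<mapsto> c \<odot> \<one>\<close>.\<close>

definition lscal :: "('k, 'r, 'x) module_scheme \<Rightarrow> ('r, 'm, 'y) module_scheme \<Rightarrow> 'k \<Rightarrow> 'm \<Rightarrow> 'm"
  where "lscal R M c x = (c \<odot>\<^bsub>R\<^esub> \<one>\<^bsub>R\<^esub>) \<odot>\<^bsub>M\<^esub> x"

definition rscal :: "('k, 'r, 'x) module_scheme \<Rightarrow> ('r, 's, 'y) rmodule_scheme \<Rightarrow> 'k \<Rightarrow> 's \<Rightarrow> 's"
  where "rscal R S c x = x \<oslash>\<^bsub>S\<^esub> (c \<odot>\<^bsub>R\<^esub> \<one>\<^bsub>R\<^esub>)"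

locale left_mrb_module = A?: mrb_algebra K R \<Omega> lam P + M?: left_module R M
  for K :: "('k, 'x) ring_scheme" (structure) and R :: "('k, 'r, 'y) module_scheme" (structure)
    and \<Omega> :: "'w set" and lam :: "'w \<Rightarrow> 'k" and P :: "'w \<Rightarrow> 'r \<Rightarrow> 'r"
    and M :: "('r, 'm, 'z) module_scheme" (structure) +
  fixes mop :: "'w \<Rightarrow> 'm \<Rightarrow> 'm"
  assumes mop_closed: "\<lbrakk>\<alpha> \<in> \<Omega>; x \<in> carrier M\<rbrakk> \<Longrightarrow> mop \<alpha> x \<in> carrier M"
    and mop_add: "\<lbrakk>\<alpha> \<in> \<Omega>; x \<in> carrier M; y \<in> carrier M\<rbrakk> \<Longrightarrow>
        mop \<alpha> (x \<oplus>\<^bsub>M\<^esub> y) = mop \<alpha> x \<oplus>\<^bsub>M\<^esub> mop \<alpha> y"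
    and mop_scal: "\<lbrakk>\<alpha> \<in> \<Omega>; c \<in> carrier K; x \<in> carrier M\<rbrakk> \<Longrightarrow>
        mop \<alpha> (lscal R M c x) = lscal R M c (mop \<alpha> x)"
    and mop_rota_baxter: "\<lbrakk>\<alpha> \<in> \<Omega>; \<beta> \<in> \<Omega>; r \<in> carrier R; x \<in> carrier M\<rbrakk> \<Longrightarrow>
        P \<alpha> r \<odot>\<^bsub>M\<^esub> mop \<beta> x =
          mop \<alpha> (r \<odot>\<^bsub>M\<^esub> mop \<beta> x) \<oplus>\<^bsub>M\<^esub> mop \<beta> (P \<alpha> r \<odot>\<^bsub>M\<^esub> x)
          \<oplus>\<^bsub>M\<^esub> lscal R M (lam \<beta>) (mop \<alpha> (r \<odot>\<^bsub>M\<^esub> x))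
          \<oplus>\<^bsub>M\<^esub> lscal R M (lam \<alpha>) (mop \<beta> (r \<odot>\<^bsub>M\<^esub> x))"

locale right_mrb_module = A?: mrb_algebra K R \<Omega> lam P + S?: right_module R S
  for K :: "('k, 'x) ring_scheme" (structure) and R :: "('k, 'r, 'y) module_scheme" (structure)
    and \<Omega> :: "'w set" and lam :: "'w \<Rightarrow> 'k" and P :: "'w \<Rightarrow> 'r \<Rightarrow> 'r"
    and S :: "('r, 's, 'z) rmodule_scheme" (structure) +
  fixes sop :: "'w \<Rightarrow> 's \<Rightarrow> 's"
  assumes sop_closed: "\<lbrakk>\<alpha> \<in> \<Omega>; x \<in> carrier S\<rbrakk> \<Longrightarrow> sop \<alpha> x \<in> carrier S"
    and sop_add: "\<lbrakk>\<alpha> \<in> \<Omega>; x \<in> carrier S; y \<in> carrier S\<rbrakk> \<Longrightarrow>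
        sop \<alpha> (x \<oplus>\<^bsub>S\<^esub> y) = sop \<alpha> x \<oplus>\<^bsub>S\<^esub> sop \<alpha> y"
    and sop_scal: "\<lbrakk>\<alpha> \<in> \<Omega>; c \<in> carrier K; x \<in> carrier S\<rbrakk> \<Longrightarrow>
        sop \<alpha> (rscal R S c x) = rscal R S c (sop \<alpha> x)"
    and sop_rota_baxter: "\<lbrakk>\<alpha> \<in> \<Omega>; \<beta> \<in> \<Omega>; r \<in> carrier R; x \<in> carrier S\<rbrakk> \<Longrightarrow>
        sop \<beta> (x \<oslash>\<^bsub>S\<^esub> P \<alpha> r) =
          sop \<beta> (sop \<alpha> x \<oslash>\<^bsub>S\<^esub> r) \<oplus>\<^bsub>S\<^esub> sop \<beta> x \<oslash>\<^bsub>S\<^esub> P \<alpha> r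
          \<oplus>\<^bsub>S\<^esub> rscal R S (lam \<beta>) (sop \<alpha> x \<oslash>\<^bsub>S\<^esub> r)
          \<oplus>\<^bsub>S\<^esub> rscal R S (lam \<alpha>) (sop \<beta> x \<oslash>\<^bsub>S\<^esub> r)"

definition left_mrb_hom ::
    "('k, 'r, 'x) module_scheme \<Rightarrow> 'w set \<Rightarrow> ('r, 'm, 'y) module_scheme \<Rightarrow> ('w \<Rightarrow> 'm \<Rightarrow> 'm) \<Rightarrow>
      ('r, 'n, 'z) module_scheme \<Rightarrow> ('w \<Rightarrow> 'n \<Rightarrow> 'n) \<Rightarrow> ('m \<Rightarrow> 'n) set"
  where "left_mrb_hom R \<Omega> M mop N nop = {h \<in> hom (add_monoid M) (add_monoid N).
    (\<forall>r\<in>carrier R. \<forall>x\<in>carrier M. h (r \<odot>\<^bsub>M\<^esub> x) = r \<odot>\<^bsub>N\<^esub> h x) \<and>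
    (\<forall>\<omega>\<in>\<Omega>. \<forall>x\<in>carrier M. h (mop \<omega> x) = nop \<omega> (h x))}"

definition right_mrb_hom ::
    "('k, 'r, 'x) module_scheme \<Rightarrow> 'w set \<Rightarrow> ('r, 'm, 'y) rmodule_scheme \<Rightarrow> ('w \<Rightarrow> 'm \<Rightarrow> 'm) \<Rightarrow>
      ('r, 'n, 'z) rmodule_scheme \<Rightarrow> ('w \<Rightarrow> 'n \<Rightarrow> 'n) \<Rightarrow> ('m \<Rightarrow> 'n) set"
  where "right_mrb_hom R \<Omega> M mop N nop = {h \<in> hom (add_monoid M) (add_monoid N).
    (\<forall>r\<in>carrier R. \<forall>x\<in>carrier M. h (x \<oslash>\<^bsub>M\<^esub> r) = h x \<oslash>\<^bsub>N\<^esub> r) \<and>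
    (\<forall>\<omega>\<in>\<Omega>. \<forall>x\<in>carrier M. h (mop \<omega> x) = nop \<omega> (h x))}"

section \<open>Projective modules\<close>

text \<open>HOL cannot quantify over types inside a definition, so the test modules \<open>M\<close> and \<open>N\<close> range over all
  modules whose carrier is a set of elements of an explicit type \<open>'u\<close>, the universe.
  Used as an assumption, projectivity relative to one fixed universe follows from projectivity against
  all modules.\<close>

definition left_mrb_projective ::
    "'u itself \<Rightarrow> ('k, 'x) ring_scheme \<Rightarrow> ('k, 'r, 'y) module_scheme \<Rightarrow> 'w set \<Rightarrow> ('w \<Rightarrow> 'k) \<Rightarrow>
      ('w \<Rightarrow> 'r \<Rightarrow> 'r) \<Rightarrow> ('r, 's, 'z) module_scheme \<Rightarrow> ('w \<Rightarrow> 's \<Rightarrow> 's) \<Rightarrow> bool"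
  where "left_mrb_projective (_ :: 'u itself) K R \<Omega> lam P S sop \<longleftrightarrow>
    left_mrb_module K R \<Omega> lam P S sop \<and>
    (\<forall>(M :: ('r, 'u) module) mop (N :: ('r, 'u) module) nop \<theta> \<phi>.
      left_mrb_module K R \<Omega> lam P M mop \<longrightarrow>
      left_mrb_module K R \<Omega> lam P N nop \<longrightarrow>
      \<theta> \<in> left_mrb_hom R \<Omega> M mop N nop \<longrightarrow> \<theta> ` carrier M = carrier N \<longrightarrow>
      \<phi> \<in> left_mrb_hom R \<Omega> S sop N nop \<longrightarrow>
      (\<exists>\<psi> \<in> left_mrb_hom R \<Omega> S sop M mop. \<forall>x\<in>carrier S. \<phi> x = \<theta> (\<psi> x)))"

text \<open>A universe that contains, up to isomorphism, every module generated by elements indexed by \<open>'s\<close>: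
  such a module is a quotient of the free abelian group on the expressions \<open>a\<^sub>1 (\<dots> (a\<^sub>n x))\<close>, where each
  \<open>a\<^sub>i\<close> is an element of \<open>R\<close> or one of the operators and \<open>x :: 's\<close>; its elements are sets of
  formal integer combinations of such expressions. In particular it contains a copy of every module
  with carrier in \<open>'s\<close> and of the free module on that carrier.\<close>

type_synonym ('r, 'w, 's) word_universe = "((('r + 'w) list \<times> 's) \<Rightarrow>\<^sub>0 int) set"

section \<open>Tensor products and flat modules\<close>

definition tensor_generators ::
    "('r, 's, 'x) rmodule_scheme \<Rightarrow> ('r, 'm, 'y) module_scheme \<Rightarrow> (('s \<times> 'm) \<Rightarrow>\<^sub>0 int) monoid"
  where "tensor_generators S M = free_Abelian_group (carrier S \<times> carrier M)"

definition tensor_relations ::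
    "('k, 'r, 'z) module_scheme \<Rightarrow> 'w set \<Rightarrow> ('r, 's, 'x) rmodule_scheme \<Rightarrow> ('w \<Rightarrow> 's \<Rightarrow> 's) \<Rightarrow>
      ('r, 'm, 'y) module_scheme \<Rightarrow> ('w \<Rightarrow> 'm \<Rightarrow> 'm) \<Rightarrow> (('s \<times> 'm) \<Rightarrow>\<^sub>0 int) set"
  where "tensor_relations R \<Omega> S sop M mop = generate (tensor_generators S M)
    ({frag_of (s \<oplus>\<^bsub>S\<^esub> s', m) - frag_of (s, m) - frag_of (s', m) | s s' m.
        s \<in> carrier S \<and> s' \<in> carrier S \<and> m \<in> carrier M} \<union>
     {frag_of (s, m \<oplus>\<^bsub>M\<^esub> m') - frag_of (s, m) - frag_of (s, m') | s m m'.
        s \<in> carrier S \<and> m \<in> carrier M \<and> m' \<in> carrier M} \<union>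
     {frag_of (s \<oslash>\<^bsub>S\<^esub> r, m) - frag_of (s, r \<odot>\<^bsub>M\<^esub> m) | s r m.
        s \<in> carrier S \<and> r \<in> carrier R \<and> m \<in> carrier M} \<union>
     {frag_of (sop \<omega> s, m) - frag_of (s, mop \<omega> m) | \<omega> s m.
        \<omega> \<in> \<Omega> \<and> s \<in> carrier S \<and> m \<in> carrier M})"

definition mrb_tensor ::
    "('k, 'r, 'z) module_scheme \<Rightarrow> 'w set \<Rightarrow> ('r, 's, 'x) rmodule_scheme \<Rightarrow> ('w \<Rightarrow> 's \<Rightarrow> 's) \<Rightarrow>
      ('r, 'm, 'y) module_scheme \<Rightarrow> ('w \<Rightarrow> 'm \<Rightarrow> 'm) \<Rightarrow> (('s \<times> 'm) \<Rightarrow>\<^sub>0 int) set monoid"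
  where "mrb_tensor R \<Omega> S sop M mop =
    tensor_generators S M Mod tensor_relations R \<Omega> S sop M mop"

text \<open>The action of the tensor functor on a homomorphism \<open>f\<close> from \<open>S\<close> to the right module \<open>T\<close>.
  The image of a coset \<open>U\<close> under the map induced by \<open>(s, m) \<mapsto> (f s, m)\<close> is a subset of a unique
  coset in the codomain, recovered by adding the subgroup of relations. The source enters only
  through its coset \<open>U\<close>.\<close>

definition mrb_tensor_map ::
    "('k, 'r, 'z) module_scheme \<Rightarrow> 'w set \<Rightarrow> ('r, 't, 'x) rmodule_scheme \<Rightarrow> ('w \<Rightarrow> 't \<Rightarrow> 't) \<Rightarrow>
      ('r, 'm, 'y) module_scheme \<Rightarrow> ('w \<Rightarrow> 'm \<Rightarrow> 'm) \<Rightarrow> ('s \<Rightarrow> 't) \<Rightarrow>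
      (('s \<times> 'm) \<Rightarrow>\<^sub>0 int) set \<Rightarrow> (('t \<times> 'm) \<Rightarrow>\<^sub>0 int) set"
  where "mrb_tensor_map R \<Omega> T t_op M mop f U =
    tensor_relations R \<Omega> T t_op M mop <#>\<^bsub>tensor_generators T M\<^esub>
      (frag_extend (\<lambda>(s, m). frag_of (f s, m)) ` U)"

text \<open>\<open>exact_seq\<close> of the library requires all groups of a sequence to have the same type of elements.\<close>

definition short_exact ::
    "('a, 'x) monoid_scheme \<Rightarrow> ('b, 'y) monoid_scheme \<Rightarrow> ('c, 'z) monoid_scheme \<Rightarrow>
      ('a \<Rightarrow> 'b) \<Rightarrow> ('b \<Rightarrow> 'c) \<Rightarrow> bool"
  where "short_exact A B C f g \<longleftrightarrow>
    group_hom A B f \<and> group_hom B C g \<and>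
    inj_on f (carrier A) \<and> f ` carrier A = kernel B C g \<and> g ` carrier B = carrier C"

text \<open>The types \<open>'a\<close>, \<open>'b\<close>, \<open>'c\<close> of elements of the three modules of a short exact sequence are
  parameters; they are to be left arbitrary.\<close>

definition left_mrb_flat ::
    "'a itself \<Rightarrow> 'b itself \<Rightarrow> 'c itself \<Rightarrow> ('k, 'x) ring_scheme \<Rightarrow> ('k, 'r, 'y) module_scheme \<Rightarrow>
      'w set \<Rightarrow> ('w \<Rightarrow> 'k) \<Rightarrow> ('w \<Rightarrow> 'r \<Rightarrow> 'r) \<Rightarrow>
      ('r, 'm, 'z) module_scheme \<Rightarrow> ('w \<Rightarrow> 'm \<Rightarrow> 'm) \<Rightarrow> bool"
  where "left_mrb_flat (_ :: 'a itself) (_ :: 'b itself) (_ :: 'c itself) K R \<Omega> lam P M mop \<longleftrightarrow>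
    left_mrb_module K R \<Omega> lam P M mop \<and>
    (\<forall>(A :: ('r, 'a) rmodule) aop (B :: ('r, 'b) rmodule) bop (C :: ('r, 'c) rmodule) cop f g.
      right_mrb_module K R \<Omega> lam P A aop \<longrightarrow>
      right_mrb_module K R \<Omega> lam P B bop \<longrightarrow>
      right_mrb_module K R \<Omega> lam P C cop \<longrightarrow>
      f \<in> right_mrb_hom R \<Omega> A aop B bop \<longrightarrow>
      g \<in> right_mrb_hom R \<Omega> B bop C cop \<longrightarrow>
      short_exact (add_monoid A) (add_monoid B) (add_monoid C) f g \<longrightarrow>
      short_exact (mrb_tensor R \<Omega> A aop M mop) (mrb_tensor R \<Omega> B bop M mop)
        (mrb_tensor R \<Omega> C cop M mop)
        (mrb_tensor_map R \<Omega> B bop M mop f) (mrb_tensor_map R \<Omega> C cop M mop g))"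

end

theory Submission
  imports Defs
begin

text \<open>
  Left and right modules over a multiple Rota-Baxter algebra are left and right modules over one ring:
  the one generated by \<open>R\<close> and a letter for each operator, in which the letters commute with the scalars
  and satisfy the relation that the Rota-Baxter identity for modules expresses. The tensor product is the
  tensor product over that ring, and the classical reason for flatness applies: a projective module \<open>M\<close> is a retract of a free module,
  so it has a dual basis \<open>x = \<Sum>\<^sub>t u\<^sub>t(x) \<cdot> t\<close> with coefficients \<open>u\<^sub>t(x)\<close> in the ring, and the maps
  \<open>b \<otimes> x \<mapsto> b \<cdot> u\<^sub>t(x)\<close> from \<open>B \<otimes> M\<close> to \<open>B\<close> are natural in \<open>B\<close>. If \<open>f\<close> is an injective homomorphism
  from \<open>A\<close> to \<open>B\<close> and \<open>f \<otimes> M\<close> kills \<open>\<Sum>\<^sub>i a\<^sub>i \<otimes> x\<^sub>i\<close>, then \<open>f (\<Sum>\<^sub>i a\<^sub>i \<cdot> u\<^sub>t(x\<^sub>i)) = 0\<close> for all \<open>t\<close>, hence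
  \<open>\<Sum>\<^sub>i a\<^sub>i \<cdot> u\<^sub>t(x\<^sub>i) = 0\<close>, and \<open>\<Sum>\<^sub>i a\<^sub>i \<otimes> x\<^sub>i = \<Sum>\<^sub>t (\<Sum>\<^sub>i a\<^sub>i \<cdot> u\<^sub>t(x\<^sub>i)) \<otimes> t = 0\<close>.

  Neither the ring nor the free module is constructed. In place of the free module stands a quotient of
  the free abelian group on the expressions \<open>l\<^sub>1 (\<dots> (l\<^sub>n x))\<close>, with letters \<open>l\<^sub>i\<close> from \<open>R\<close> and the
  index set and \<open>x\<close> in \<open>M\<close>. Two things are asked of it: it must map onto \<open>M\<close>, and every element of
  the given module \<open>B\<close> must pair with it. So the subgroup divided out is the largest one on which
  both evaluations vanish, evaluation in \<open>M\<close> (\<open>word_kernel\<close>) and letting the words act on elements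
  of \<open>B\<close> (\<open>spread_kernel\<close>). That the quotient is a module then follows from the module axioms of \<open>M\<close>
  and \<open>B\<close> (\<open>word_congruence_word_kernel\<close>, \<open>word_congruence_spread_kernel\<close>). The dual basis appears
  as a choice \<open>y x\<close> of combinations of words that evaluate to \<open>x\<close> and depend on \<open>x\<close> linearly modulo
  that subgroup (\<open>projective_section\<close>); the argument above becomes \<open>mrb_tensor_map_inj\<close>.

  Exactness at the other two places holds for every left module (\<open>mrb_tensor_map_kernel\<close>,
  \<open>mrb_tensor_map_surj\<close>).
\<close>

section \<open>Subgroups and quotients of free abelian groups\<close>

text \<open>A congruence of \<open>x\<close> and \<open>y\<close> is written \<open>x - y \<in> N\<close>. The subtraction of the type of formal combinations,
in place of the operations of \<^const>\<open>free_Abelian_group\<close>, leaves computations in the quotient to the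
rewrite rules for abelian group types.\<close>

locale frag_subgroup =
  fixes B :: "'a set" and N :: "('a \<Rightarrow>\<^sub>0 int) set"
  assumes keys_mem: "x \<in> N \<Longrightarrow> Poly_Mapping.keys x \<subseteq> B"
    and zero_mem [simp]: "0 \<in> N"
    and diff_mem: "x \<in> N \<Longrightarrow> y \<in> N \<Longrightarrow> x - y \<in> N"
begin

lemma uminus_mem: "x \<in> N \<Longrightarrow> - x \<in> N"
  using diff_mem[of 0 x] by simp

lemma add_mem: "x \<in> N \<Longrightarrow> y \<in> N \<Longrightarrow> x + y \<in> N"
  using diff_mem[of x "- y"] uminus_mem[of y] by simp

lemma sum_mem: "(\<And>i. i \<in> I \<Longrightarrow> f i \<in> N) \<Longrightarrow> sum f I \<in> N"
  by (induction I rule: infinite_finite_induct) (simp_all add: add_mem)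

lemma cong_sym: "x - y \<in> N \<Longrightarrow> y - x \<in> N"
  using uminus_mem[of "x - y"] by simp

lemma cong_trans: "x - y \<in> N \<Longrightarrow> y - z \<in> N \<Longrightarrow> x - z \<in> N"
  using add_mem[of "x - y" "y - z"] by simp

lemma cong_mem: "x - y \<in> N \<Longrightarrow> y \<in> N \<Longrightarrow> x \<in> N"
  using add_mem[of "x - y" "y"] by simp

lemma subgroup_free: "subgroup N (free_Abelian_group B)"
  by (rule subgroup.intro)
    (use keys_mem zero_mem add_mem uminus_mem in \<open>auto simp: inv_free_Abelian_group\<close>)

abbreviation cls :: "('a \<Rightarrow>\<^sub>0 int) \<Rightarrow> ('a \<Rightarrow>\<^sub>0 int) set"
  where "cls x \<equiv> N #>\<^bsub>free_Abelian_group B\<^esub> x"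

lemma cls_mem_iff: "y \<in> cls x \<longleftrightarrow> y - x \<in> N"
  unfolding r_coset_def by (auto intro: bexI[of _ "y - x"])

lemma cls_eq_iff: "cls x = cls y \<longleftrightarrow> x - y \<in> N"
proof
  assume "cls x = cls y"
  moreover have "x \<in> cls x" by (simp add: cls_mem_iff)
  ultimately show "x - y \<in> N" by (simp add: cls_mem_iff)
next
  assume xy: "x - y \<in> N"
  show "cls x = cls y"
    using cong_trans[OF _ xy] cong_trans[OF _ cong_sym[OF xy]] by (auto simp: cls_mem_iff)
qed

lemma cls_zero: "cls 0 = N"
  by (auto simp: cls_mem_iff)

lemma cls_add: "cls x <#>\<^bsub>free_Abelian_group B\<^esub> cls y = cls (x + y)"
proof (intro equalityI subsetI)
  fix z assume "z \<in> cls x <#>\<^bsub>free_Abelian_group B\<^esub> cls y"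
  then obtain u v where "u - x \<in> N" "v - y \<in> N" "z = u + v"
    by (auto simp: set_mult_def cls_mem_iff)
  then show "z \<in> cls (x + y)"
    using add_mem[of "u - x" "v - y"] by (simp add: cls_mem_iff algebra_simps)
next
  fix z assume "z \<in> cls (x + y)"
  then have "z - y \<in> cls x" "y \<in> cls y" "z = (z - y) + y"
    by (simp_all add: cls_mem_iff algebra_simps)
  then show "z \<in> cls x <#>\<^bsub>free_Abelian_group B\<^esub> cls y"
    unfolding set_mult_def by force
qed

lemma carrier_quotient: "carrier (free_Abelian_group B Mod N) = cls ` {x. Poly_Mapping.keys x \<subseteq> B}"
  by (auto simp: FactGroup_def RCOSETS_def)

lemma mult_quotient: "U \<otimes>\<^bsub>free_Abelian_group B Mod N\<^esub> V = U <#>\<^bsub>free_Abelian_group B\<^esub> V"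
  by (simp add: FactGroup_def)

lemma one_quotient: "\<one>\<^bsub>free_Abelian_group B Mod N\<^esub> = N"
  by (simp add: FactGroup_def)

lemma comm_group_quotient: "comm_group (free_Abelian_group B Mod N)"
  by (intro comm_group.abelian_FactGroup abelian_free_Abelian_group subgroup_free)

text \<open>The image of a coset under an additive map lies in a single coset as soon as the subgroup is
  mapped into the subgroup of the codomain; adding the latter fills up that coset.\<close>

lemma induced_cls:
  assumes "frag_subgroup Y M" and "\<And>x y. h (x - y) = h x - h y" and "h ` M \<subseteq> N"
  shows "N <#>\<^bsub>free_Abelian_group B\<^esub> h ` (M #>\<^bsub>free_Abelian_group Y\<^esub> x) = cls (h x)"
proof -
  interpret M: frag_subgroup Y M by fact
  show ?thesis
  proof (intro equalityI subsetI)
    fix z assume "z \<in> N <#>\<^bsub>free_Abelian_group B\<^esub> h ` M.cls x"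
    then obtain n y where n: "n \<in> N" and y: "y - x \<in> M" and z: "z = n + h y"
      by (auto simp: set_mult_def M.cls_mem_iff)
    have "h y - h x \<in> N"
      using y assms(2)[of y x] assms(3) by force
    then show "z \<in> cls (h x)"
      using add_mem[OF n, of "h y - h x"] z by (simp add: cls_mem_iff algebra_simps)
  next
    fix z assume "z \<in> cls (h x)"
    then have "z - h x \<in> N" "h x \<in> h ` M.cls x" "z = (z - h x) + h x"
      by (auto simp: cls_mem_iff M.cls_mem_iff)
    then show "z \<in> N <#>\<^bsub>free_Abelian_group B\<^esub> h ` M.cls x"
      unfolding set_mult_def by force
  qed
qed

end

lemma frag_subgroup_Int:
  "frag_subgroup B M \<Longrightarrow> frag_subgroup B N \<Longrightarrow> frag_subgroup B (M \<inter> N)"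
  unfolding frag_subgroup_def by blast

lemma keys_frag_extend_subset:
  assumes "Poly_Mapping.keys x \<subseteq> B" and "\<And>a. a \<in> B \<Longrightarrow> Poly_Mapping.keys (k a) \<subseteq> Y"
  shows "Poly_Mapping.keys (frag_extend k x) \<subseteq> Y"
  using keys_frag_extend[of k x] assms by blast

lemma keys_diff_subset:
  "Poly_Mapping.keys x \<subseteq> B \<Longrightarrow> Poly_Mapping.keys y \<subseteq> B \<Longrightarrow> Poly_Mapping.keys (x - y) \<subseteq> B"
  for x y :: "'a \<Rightarrow>\<^sub>0 int"
  using keys_diff[of x y] by blast

lemma keys_add_subset:
  "Poly_Mapping.keys x \<subseteq> B \<Longrightarrow> Poly_Mapping.keys y \<subseteq> B \<Longrightarrow> Poly_Mapping.keys (x + y) \<subseteq> B"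
  for x y :: "'a \<Rightarrow>\<^sub>0 int"
  using Poly_Mapping.keys_add[of x y] by blast

lemma frag_extend_hom:
  assumes "\<And>a. a \<in> B \<Longrightarrow> Poly_Mapping.keys (k a) \<subseteq> C"
  shows "frag_extend k \<in> hom (free_Abelian_group B) (free_Abelian_group C)"
  by (rule homI) (use keys_frag_extend_subset[of _ B k C] assms in \<open>auto simp: frag_extend_add\<close>)

lemma quotient_hom:
  assumes "frag_subgroup B M" and "frag_subgroup Y N"
    and "\<And>a. a \<in> B \<Longrightarrow> Poly_Mapping.keys (k a) \<subseteq> Y" and "frag_extend k ` M \<subseteq> N"
  shows "group_hom (free_Abelian_group B Mod M) (free_Abelian_group Y Mod N)
    (\<lambda>U. N <#>\<^bsub>free_Abelian_group Y\<^esub> frag_extend k ` U)"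
proof -
  interpret M: frag_subgroup B M by fact
  interpret N: frag_subgroup Y N by fact
  have eq: "N <#>\<^bsub>free_Abelian_group Y\<^esub> frag_extend k ` M.cls x = N.cls (frag_extend k x)" for x
    by (rule N.induced_cls[OF assms(1) frag_extend_diff assms(4)])
  have "(\<lambda>U. N <#>\<^bsub>free_Abelian_group Y\<^esub> frag_extend k ` U)
      \<in> hom (free_Abelian_group B Mod M) (free_Abelian_group Y Mod N)"
  proof (rule homI)
    fix U assume "U \<in> carrier (free_Abelian_group B Mod M)"
    then obtain x where "U = M.cls x" "Poly_Mapping.keys x \<subseteq> B"
      by (auto simp: M.carrier_quotient)
    then show "N <#>\<^bsub>free_Abelian_group Y\<^esub> frag_extend k ` U \<in> carrier (free_Abelian_group Y Mod N)"
      using keys_frag_extend_subset[of x B k Y] assms(3) by (simp add: N.carrier_quotient eq)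
  next
    fix U V
    assume "U \<in> carrier (free_Abelian_group B Mod M)" "V \<in> carrier (free_Abelian_group B Mod M)"
    then obtain x y where "U = M.cls x" "V = M.cls y"
      by (auto simp: M.carrier_quotient)
    then show "N <#>\<^bsub>free_Abelian_group Y\<^esub> frag_extend k ` (U \<otimes>\<^bsub>free_Abelian_group B Mod M\<^esub> V) =
        (N <#>\<^bsub>free_Abelian_group Y\<^esub> frag_extend k ` U) \<otimes>\<^bsub>free_Abelian_group Y Mod N\<^esub>
        (N <#>\<^bsub>free_Abelian_group Y\<^esub> frag_extend k ` V)"
      by (simp add: M.mult_quotient N.mult_quotient eq M.cls_add N.cls_add frag_extend_add)
  qed
  then show ?thesis
    using M.comm_group_quotient N.comm_group_quotient
    by (simp add: group_hom_def group_hom_axioms_def comm_group_def)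
qed

text \<open>Here the values lie in the carrier of an arbitrary abelian group; maps whose values are formal
  combinations are extended by \<^const>\<open>frag_extend\<close>.\<close>

definition linear_extension :: "'a set \<Rightarrow> ('b, 'z) ring_scheme \<Rightarrow> ('a \<Rightarrow> 'b) \<Rightarrow> ('a \<Rightarrow>\<^sub>0 int) \<Rightarrow> 'b"
  where "linear_extension B G f = (SOME h. h \<in> hom (free_Abelian_group B) (add_monoid G) \<and>
    (\<forall>a\<in>B. h (frag_of a) = f a))"

context abelian_group
begin

lemma linear_extension:
  assumes "f ` B \<subseteq> carrier G"
  shows "linear_extension B G f \<in> hom (free_Abelian_group B) (add_monoid G)"
    and "a \<in> B \<Longrightarrow> linear_extension B G f (frag_of a) = f a"
proof -
  interpret add: comm_group "add_monoid G" by (rule a_comm_group)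
  have "\<exists>h. h \<in> hom (free_Abelian_group B) (add_monoid G) \<and> (\<forall>a\<in>B. h (frag_of a) = f a)"
    by (rule add.free_Abelian_group_universal[of f B]) (use assms in auto)
  from someI_ex[OF this] show "linear_extension B G f \<in> hom (free_Abelian_group B) (add_monoid G)"
    and "a \<in> B \<Longrightarrow> linear_extension B G f (frag_of a) = f a"
    by (simp_all add: linear_extension_def)
qed

lemma hom_free_diff:
  assumes "h \<in> hom (free_Abelian_group B) (add_monoid G)"
    and "Poly_Mapping.keys x \<subseteq> B" "Poly_Mapping.keys y \<subseteq> B"
  shows "h (x - y) = h x \<ominus> h y"
proof -
  interpret h: group_hom "free_Abelian_group B" "add_monoid G" h
    using assms(1) a_group by (simp add: group_hom_def group_hom_axioms_def)
  have "h (x + - y) = h x \<oplus> h (- y)"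
    using h.hom_mult[of x "- y"] assms by simp
  moreover have "h (- y) = \<ominus> h y"
    using h.hom_inv[of y] assms by (simp add: a_inv_def)
  ultimately show ?thesis by (simp add: a_minus_def)
qed

lemma hom_free_zero:
  "h \<in> hom (free_Abelian_group B) (add_monoid G) \<Longrightarrow> h 0 = \<zero>"
  using group_hom.hom_one[of "free_Abelian_group B" "add_monoid G" h] a_group
  by (simp add: group_hom_def group_hom_axioms_def)

lemma hom_free_add:
  "h \<in> hom (free_Abelian_group B) (add_monoid G) \<Longrightarrow> Poly_Mapping.keys x \<subseteq> B \<Longrightarrow>
    Poly_Mapping.keys y \<subseteq> B \<Longrightarrow> h (x + y) = h x \<oplus> h y"
  using hom_mult[of h "free_Abelian_group B" "add_monoid G" x y] by simp

lemma hom_free_closed: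
  "h \<in> hom (free_Abelian_group B) (add_monoid G) \<Longrightarrow> Poly_Mapping.keys x \<subseteq> B \<Longrightarrow> h x \<in> carrier G"
  using hom_in_carrier[of h "free_Abelian_group B" "add_monoid G" x] by simp

lemma minus_eq_zero_iff: "x \<in> carrier G \<Longrightarrow> y \<in> carrier G \<Longrightarrow> x \<ominus> y = \<zero> \<longleftrightarrow> x = y"
  by (metis a_inv_closed a_minus_def minus_equality minus_minus r_neg)

lemma hom_free_eqI:
  assumes "g \<in> hom (free_Abelian_group B) (add_monoid G)"
    and "h \<in> hom (free_Abelian_group B) (add_monoid G)"
    and "\<And>a. a \<in> B \<Longrightarrow> g (frag_of a) = h (frag_of a)" and "Poly_Mapping.keys x \<subseteq> B"
  shows "g x = h x"
  using assms(4)
  by (rule free_Abelian_group_induct)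
    (simp_all add: hom_free_zero[OF assms(1)] hom_free_zero[OF assms(2)]
      hom_free_diff[OF assms(1)] hom_free_diff[OF assms(2)] assms(3))

lemma frag_subgroup_kernel:
  assumes "h \<in> hom (free_Abelian_group B) (add_monoid G)"
  shows "frag_subgroup B {x. Poly_Mapping.keys x \<subseteq> B \<and> h x = \<zero>}"
  by unfold_locales
    (auto simp: hom_free_zero[OF assms] hom_free_diff[OF assms] minus_eq_zero_iff
      dest: subsetD[OF keys_diff])

end

section \<open>Modules of words\<close>

abbreviation letters :: "('r, 'x) ring_scheme \<Rightarrow> 'w set \<Rightarrow> ('r + 'w) set"
  where "letters R \<Omega> \<equiv> Sum_Type.Plus (carrier R) \<Omega>"

definition word_gens :: "('r, 'x) ring_scheme \<Rightarrow> 'w set \<Rightarrow> 's set \<Rightarrow> (('r + 'w) list \<times> 's) set"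
  where "word_gens R \<Omega> E = lists (letters R \<Omega>) \<times> E"

text \<open>Prepending a letter is how \<open>R\<close> and the operators act on combinations of words.\<close>

definition prepend :: "'l \<Rightarrow> (('l list \<times> 's) \<Rightarrow>\<^sub>0 int) \<Rightarrow> (('l list \<times> 's) \<Rightarrow>\<^sub>0 int)"
  where "prepend l = frag_extend (\<lambda>(w, s). frag_of (l # w, s))"

text \<open>The action on a coset \<open>U\<close> is the map that prepending induces: the image of \<open>U\<close> lies in a single coset,
which adding \<open>N\<close> recovers.\<close>

definition word_module ::
    "('k, 'r, 'y) module_scheme \<Rightarrow> 'w set \<Rightarrow> 's set \<Rightarrow> ((('r + 'w) list \<times> 's) \<Rightarrow>\<^sub>0 int) set \<Rightarrow>
      ('r, ((('r + 'w) list \<times> 's) \<Rightarrow>\<^sub>0 int) set) module"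
  where "word_module R \<Omega> E N =
    \<lparr>carrier = rcosets\<^bsub>free_Abelian_group (word_gens R \<Omega> E)\<^esub> N, monoid.mult = undefined, one = undefined,
     ring.zero = N, ring.add = set_mult (free_Abelian_group (word_gens R \<Omega> E)),
     smult = (\<lambda>r U. N <#>\<^bsub>free_Abelian_group (word_gens R \<Omega> E)\<^esub> prepend (Inl r) ` U)\<rparr>"

definition word_op ::
    "('k, 'r, 'y) module_scheme \<Rightarrow> 'w set \<Rightarrow> 's set \<Rightarrow> ((('r + 'w) list \<times> 's) \<Rightarrow>\<^sub>0 int) set \<Rightarrow>
      'w \<Rightarrow> ((('r + 'w) list \<times> 's) \<Rightarrow>\<^sub>0 int) set \<Rightarrow> ((('r + 'w) list \<times> 's) \<Rightarrow>\<^sub>0 int) set"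
  where "word_op R \<Omega> E N \<omega> U = N <#>\<^bsub>free_Abelian_group (word_gens R \<Omega> E)\<^esub> prepend (Inr \<omega>) ` U"

lemma prepend_add: "prepend l (x + y) = prepend l x + prepend l y"
  by (simp add: prepend_def frag_extend_add)

lemma prepend_diff: "prepend l (x - y) = prepend l x - prepend l y"
  by (simp add: prepend_def frag_extend_diff)

lemma prepend_of [simp]: "prepend l (frag_of (w, s)) = frag_of (l # w, s)"
  by (simp add: prepend_def)

lemma keys_prepend:
  "l \<in> letters R \<Omega> \<Longrightarrow> Poly_Mapping.keys x \<subseteq> word_gens R \<Omega> E \<Longrightarrow>
    Poly_Mapping.keys (prepend l x) \<subseteq> word_gens R \<Omega> E"
  unfolding prepend_def by (erule keys_frag_extend_subset) (auto simp: word_gens_def)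

text \<open>The subgroups \<open>N\<close> for which the quotient is a left module. Additivity of the action of a letter is
automatic, since \<^const>\<open>prepend\<close> is additive; the other module axioms become membership in \<open>N\<close>. In this form
the conditions are preserved by intersections.\<close>

locale word_congruence =
  mrb_algebra K R \<Omega> lam P + frag_subgroup "word_gens R \<Omega> E" N
  for K :: "('k, 'x) ring_scheme" (structure) and R :: "('k, 'r, 'y) module_scheme" (structure)
    and \<Omega> :: "'w set" and lam :: "'w \<Rightarrow> 'k" and P :: "'w \<Rightarrow> 'r \<Rightarrow> 'r"
    and E :: "'s set" and N :: "((('r + 'w) list \<times> 's) \<Rightarrow>\<^sub>0 int) set" +
  assumes prepend_mem: "l \<in> letters R \<Omega> \<Longrightarrow> x \<in> N \<Longrightarrow> prepend l x \<in> N"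
    and add_rel: "\<lbrakk>a \<in> carrier R; b \<in> carrier R; Poly_Mapping.keys x \<subseteq> word_gens R \<Omega> E\<rbrakk> \<Longrightarrow>
      prepend (Inl (a \<oplus>\<^bsub>R\<^esub> b)) x - (prepend (Inl a) x + prepend (Inl b) x) \<in> N"
    and mult_rel: "\<lbrakk>a \<in> carrier R; b \<in> carrier R; Poly_Mapping.keys x \<subseteq> word_gens R \<Omega> E\<rbrakk> \<Longrightarrow>
      prepend (Inl (a \<otimes>\<^bsub>R\<^esub> b)) x - prepend (Inl a) (prepend (Inl b) x) \<in> N"
    and one_rel: "Poly_Mapping.keys x \<subseteq> word_gens R \<Omega> E \<Longrightarrow> prepend (Inl \<one>\<^bsub>R\<^esub>) x - x \<in> N"
    and scal_rel: "\<lbrakk>\<alpha> \<in> \<Omega>; c \<in> carrier K; Poly_Mapping.keys x \<subseteq> word_gens R \<Omega> E\<rbrakk> \<Longrightarrow>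
      prepend (Inr \<alpha>) (prepend (Inl (c \<odot>\<^bsub>R\<^esub> \<one>\<^bsub>R\<^esub>)) x)
      - prepend (Inl (c \<odot>\<^bsub>R\<^esub> \<one>\<^bsub>R\<^esub>)) (prepend (Inr \<alpha>) x) \<in> N"
    and rota_baxter_rel:
      "\<lbrakk>\<alpha> \<in> \<Omega>; \<beta> \<in> \<Omega>; r \<in> carrier R; Poly_Mapping.keys x \<subseteq> word_gens R \<Omega> E\<rbrakk> \<Longrightarrow>
      prepend (Inl (P \<alpha> r)) (prepend (Inr \<beta>) x)
      - (prepend (Inr \<alpha>) (prepend (Inl r) (prepend (Inr \<beta>) x))
        + prepend (Inr \<beta>) (prepend (Inl (P \<alpha> r)) x)
        + prepend (Inl (lam \<beta> \<odot>\<^bsub>R\<^esub> \<one>\<^bsub>R\<^esub>)) (prepend (Inr \<alpha>) (prepend (Inl r) x))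
        + prepend (Inl (lam \<alpha> \<odot>\<^bsub>R\<^esub> \<one>\<^bsub>R\<^esub>)) (prepend (Inr \<beta>) (prepend (Inl r) x))) \<in> N"
begin

abbreviation F where "F \<equiv> word_module R \<Omega> E N"
abbreviation fop where "fop \<equiv> word_op R \<Omega> E N"

lemma carrier_word_module: "carrier F = cls ` {x. Poly_Mapping.keys x \<subseteq> word_gens R \<Omega> E}"
  by (auto simp: word_module_def RCOSETS_def)

lemma cls_in_word_module: "Poly_Mapping.keys x \<subseteq> word_gens R \<Omega> E \<Longrightarrow> cls x \<in> carrier F"
  by (auto simp: carrier_word_module)

lemma add_word_module: "cls x \<oplus>\<^bsub>F\<^esub> cls y = cls (x + y)"
  by (simp add: word_module_def cls_add)

lemma induced_prepend:
  assumes "l \<in> letters R \<Omega>"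
  shows "N <#>\<^bsub>free_Abelian_group (word_gens R \<Omega> E)\<^esub> prepend l ` cls x = cls (prepend l x)"
  by (rule induced_cls) (use assms prepend_mem prepend_diff frag_subgroup_axioms in auto)

lemma smult_word_module: "r \<in> carrier R \<Longrightarrow> r \<odot>\<^bsub>F\<^esub> cls x = cls (prepend (Inl r) x)"
  using induced_prepend[of "Inl r"] by (simp add: word_module_def InlI)

lemma op_word_module: "\<omega> \<in> \<Omega> \<Longrightarrow> fop \<omega> (cls x) = cls (prepend (Inr \<omega>) x)"
  using induced_prepend[of "Inr \<omega>"] by (simp add: word_op_def InrI)

lemma abelian_group_word_module: "abelian_group F"
proof -
  interpret Q: comm_group "free_Abelian_group (word_gens R \<Omega> E) Mod N"
    by (rule comm_group_quotient)
  have "comm_group (add_monoid F)"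
    by (rule comm_groupI)
      (use Q.m_assoc Q.m_comm Q.l_one Q.l_inv_ex Q.m_closed Q.one_closed in
        \<open>auto simp: word_module_def FactGroup_def\<close>)
  then show ?thesis
    by (simp add: abelian_group_def abelian_group_axioms_def abelian_monoid_def comm_group_def)
qed

lemma left_mrb_module_word_module: "left_mrb_module K R \<Omega> lam P F fop"
proof -
  interpret F: abelian_group F by (rule abelian_group_word_module)
  note simps = add_word_module smult_word_module op_word_module cls_eq_iff InlI InrI
  have scal: "c \<odot>\<^bsub>R\<^esub> \<one>\<^bsub>R\<^esub> \<in> carrier R" if "c \<in> carrier K" for c
    using that by simp
  have "left_module R F"
  proof
    fix a U assume a: "a \<in> carrier R" and "U \<in> carrier F"
    then obtain x where x: "U = cls x" "Poly_Mapping.keys x \<subseteq> word_gens R \<Omega> E"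
      by (auto simp: carrier_word_module)
    show "a \<odot>\<^bsub>F\<^esub> U \<in> carrier F"
      using a x keys_prepend[of "Inl a" R \<Omega> x E] by (auto simp: simps intro!: cls_in_word_module)
    fix V assume "V \<in> carrier F"
    then obtain y where y: "V = cls y" "Poly_Mapping.keys y \<subseteq> word_gens R \<Omega> E"
      by (auto simp: carrier_word_module)
    show "a \<odot>\<^bsub>F\<^esub> (U \<oplus>\<^bsub>F\<^esub> V) = a \<odot>\<^bsub>F\<^esub> U \<oplus>\<^bsub>F\<^esub> a \<odot>\<^bsub>F\<^esub> V"
      using a x y by (simp add: simps prepend_add)
  next
    fix a b U assume ab: "a \<in> carrier R" "b \<in> carrier R" and "U \<in> carrier F"
    then obtain x where x: "U = cls x" "Poly_Mapping.keys x \<subseteq> word_gens R \<Omega> E"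
      by (auto simp: carrier_word_module)
    show "(a \<oplus>\<^bsub>R\<^esub> b) \<odot>\<^bsub>F\<^esub> U = a \<odot>\<^bsub>F\<^esub> U \<oplus>\<^bsub>F\<^esub> b \<odot>\<^bsub>F\<^esub> U"
      using ab x add_rel by (simp add: simps)
    show "(a \<otimes>\<^bsub>R\<^esub> b) \<odot>\<^bsub>F\<^esub> U = a \<odot>\<^bsub>F\<^esub> (b \<odot>\<^bsub>F\<^esub> U)"
      using ab x mult_rel by (simp add: simps)
  next
    fix U assume "U \<in> carrier F"
    then obtain x where x: "U = cls x" "Poly_Mapping.keys x \<subseteq> word_gens R \<Omega> E"
      by (auto simp: carrier_word_module)
    then show "\<one>\<^bsub>R\<^esub> \<odot>\<^bsub>F\<^esub> U = U"
      using one_rel by (simp add: simps)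
  qed
  moreover have "left_mrb_module_axioms K R \<Omega> lam P F fop"
  proof
    fix \<alpha> U assume \<alpha>: "\<alpha> \<in> \<Omega>" and "U \<in> carrier F"
    then obtain x where x: "U = cls x" "Poly_Mapping.keys x \<subseteq> word_gens R \<Omega> E"
      by (auto simp: carrier_word_module)
    show "fop \<alpha> U \<in> carrier F"
      using \<alpha> x keys_prepend[of "Inr \<alpha>" R \<Omega> x E] by (auto simp: simps intro!: cls_in_word_module)
    fix V assume "V \<in> carrier F"
    then obtain y where y: "V = cls y" "Poly_Mapping.keys y \<subseteq> word_gens R \<Omega> E"
      by (auto simp: carrier_word_module)
    show "fop \<alpha> (U \<oplus>\<^bsub>F\<^esub> V) = fop \<alpha> U \<oplus>\<^bsub>F\<^esub> fop \<alpha> V"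
      using \<alpha> x y by (simp add: simps prepend_add)
  next
    fix \<alpha> c U assume \<alpha>: "\<alpha> \<in> \<Omega>" and c: "c \<in> carrier K" and "U \<in> carrier F"
    then obtain x where x: "U = cls x" "Poly_Mapping.keys x \<subseteq> word_gens R \<Omega> E"
      by (auto simp: carrier_word_module)
    show "fop \<alpha> (lscal R F c U) = lscal R F c (fop \<alpha> U)"
      using \<alpha> c x scal_rel by (simp add: lscal_def simps scal)
  next
    fix \<alpha> \<beta> r U assume \<alpha>: "\<alpha> \<in> \<Omega>" "\<beta> \<in> \<Omega>" and r: "r \<in> carrier R" and "U \<in> carrier F"
    then obtain x where x: "U = cls x" "Poly_Mapping.keys x \<subseteq> word_gens R \<Omega> E"
      by (auto simp: carrier_word_module)
    show "P \<alpha> r \<odot>\<^bsub>F\<^esub> fop \<beta> U = fop \<alpha> (r \<odot>\<^bsub>F\<^esub> fop \<beta> U) \<oplus>\<^bsub>F\<^esub> fop \<beta> (P \<alpha> r \<odot>\<^bsub>F\<^esub> U)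
        \<oplus>\<^bsub>F\<^esub> lscal R F (lam \<beta>) (fop \<alpha> (r \<odot>\<^bsub>F\<^esub> U)) \<oplus>\<^bsub>F\<^esub> lscal R F (lam \<alpha>) (fop \<beta> (r \<odot>\<^bsub>F\<^esub> U))"
      using \<alpha> r x rota_baxter_rel[of \<alpha> \<beta> r x]
      by (simp add: lscal_def simps scal weight_closed P_closed)
  qed
  ultimately show ?thesis
    by (simp add: left_mrb_module_def mrb_algebra_axioms)
qed

end

text \<open>The quotient by the intersection maps to both quotients; this is how one module of words serves both the
left module and a right module.\<close>

lemma word_congruence_Int:
  assumes "word_congruence K R \<Omega> lam P E M" and "word_congruence K R \<Omega> lam P E N"
  shows "word_congruence K R \<Omega> lam P E (M \<inter> N)"
proof -
  interpret M: word_congruence K R \<Omega> lam P E M by fact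
  interpret N: word_congruence K R \<Omega> lam P E N by fact
  have "frag_subgroup (word_gens R \<Omega> E) (M \<inter> N)"
    by (intro frag_subgroup_Int M.frag_subgroup_axioms N.frag_subgroup_axioms)
  moreover have "word_congruence_axioms K R \<Omega> lam P E (M \<inter> N)"
    by unfold_locales
      (use M.prepend_mem N.prepend_mem M.add_rel N.add_rel M.mult_rel N.mult_rel M.one_rel N.one_rel
        M.scal_rel N.scal_rel M.rota_baxter_rel N.rota_baxter_rel in auto)
  ultimately show ?thesis
    by (simp add: word_congruence_def M.mrb_algebra_axioms)
qed

section \<open>Evaluating words in a left module\<close>

definition letter_act :: "('r, 'm, 'z) module_scheme \<Rightarrow> ('w \<Rightarrow> 'm \<Rightarrow> 'm) \<Rightarrow> 'r + 'w \<Rightarrow> 'm \<Rightarrow> 'm"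
  where "letter_act M mop l x = (case l of Inl r \<Rightarrow> r \<odot>\<^bsub>M\<^esub> x | Inr \<omega> \<Rightarrow> mop \<omega> x)"

text \<open>The homomorphism \<open>l\<^sub>1 \<dots> l\<^sub>n x \<mapsto> l\<^sub>1 (\<dots> (l\<^sub>n x))\<close> that presents \<open>M\<close> as a quotient of a module of words.\<close>

definition word_value ::
    "('k, 'r, 'y) module_scheme \<Rightarrow> 'w set \<Rightarrow> ('r, 'm, 'z) module_scheme \<Rightarrow> ('w \<Rightarrow> 'm \<Rightarrow> 'm) \<Rightarrow>
      ((('r + 'w) list \<times> 'm) \<Rightarrow>\<^sub>0 int) \<Rightarrow> 'm"
  where "word_value R \<Omega> M mop = linear_extension (word_gens R \<Omega> (carrier M)) M
    (\<lambda>(w, x). foldr (letter_act M mop) w x)"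

definition word_kernel ::
    "('k, 'r, 'y) module_scheme \<Rightarrow> 'w set \<Rightarrow> ('r, 'm, 'z) module_scheme \<Rightarrow> ('w \<Rightarrow> 'm \<Rightarrow> 'm) \<Rightarrow>
      ((('r + 'w) list \<times> 'm) \<Rightarrow>\<^sub>0 int) set"
  where "word_kernel R \<Omega> M mop = {x. Poly_Mapping.keys x \<subseteq> word_gens R \<Omega> (carrier M) \<and>
    word_value R \<Omega> M mop x = \<zero>\<^bsub>M\<^esub>}"

context left_mrb_module
begin

lemma letter_act_closed:
  "l \<in> letters R \<Omega> \<Longrightarrow> x \<in> carrier M \<Longrightarrow> letter_act M mop l x \<in> carrier M"
  by (auto simp: letter_act_def lact_closed mop_closed)

lemma letter_act_hom:
  "l \<in> letters R \<Omega> \<Longrightarrow> letter_act M mop l \<in> hom (add_monoid M) (add_monoid M)"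
  by (rule homI) (auto simp: letter_act_def lact_closed mop_closed lact_r_distr mop_add)

lemma foldr_letter_act_closed:
  "w \<in> lists (letters R \<Omega>) \<Longrightarrow> x \<in> carrier M \<Longrightarrow> foldr (letter_act M mop) w x \<in> carrier M"
  by (induction w) (auto intro!: letter_act_closed)

abbreviation val where "val \<equiv> word_value R \<Omega> M mop"
abbreviation gens where "gens \<equiv> word_gens R \<Omega> (carrier M)"

lemma word_value_hom: "val \<in> hom (free_Abelian_group gens) (add_monoid M)"
  and word_value_of: "(w, x) \<in> gens \<Longrightarrow> val (frag_of (w, x)) = foldr (letter_act M mop) w x"
proof -
  have *: "(\<lambda>(w, x). foldr (letter_act M mop) w x) ` gens \<subseteq> carrier M"
    using foldr_letter_act_closed by (auto simp: word_gens_def)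
  show "val \<in> hom (free_Abelian_group gens) (add_monoid M)"
    unfolding word_value_def by (rule M.linear_extension(1)[OF *])
  show "val (frag_of (w, x)) = foldr (letter_act M mop) w x" if "(w, x) \<in> gens"
    unfolding word_value_def using M.linear_extension(2)[OF * that] by simp
qed

lemmas word_value_add = M.hom_free_add[OF word_value_hom]
lemmas word_value_diff = M.hom_free_diff[OF word_value_hom]
lemmas word_value_closed = M.hom_free_closed[OF word_value_hom]

lemma word_value_prepend:
  assumes "l \<in> letters R \<Omega>" and "Poly_Mapping.keys x \<subseteq> gens"
  shows "val (prepend l x) = letter_act M mop l (val x)"
proof -
  have "prepend l \<in> hom (free_Abelian_group gens) (free_Abelian_group gens)"
    unfolding prepend_def by (rule frag_extend_hom) (use assms(1) in \<open>auto simp: word_gens_def\<close>)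
  then have "val \<circ> prepend l \<in> hom (free_Abelian_group gens) (add_monoid M)"
    by (rule hom_compose[OF _ word_value_hom])
  moreover have "letter_act M mop l \<circ> val \<in> hom (free_Abelian_group gens) (add_monoid M)"
    by (rule hom_compose[OF word_value_hom letter_act_hom[OF assms(1)]])
  moreover have "(val \<circ> prepend l) (frag_of g) = (letter_act M mop l \<circ> val) (frag_of g)"
    if "g \<in> gens" for g
    using that assms(1) by (cases g) (auto simp: word_value_of word_gens_def)
  ultimately have "(val \<circ> prepend l) x = (letter_act M mop l \<circ> val) x"
    using assms(2) by (rule M.hom_free_eqI)
  then show ?thesis by simp
qed

lemma word_kernel_iff:
  "Poly_Mapping.keys x \<subseteq> gens \<Longrightarrow> Poly_Mapping.keys y \<subseteq> gens \<Longrightarrow>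
    x - y \<in> word_kernel R \<Omega> M mop \<longleftrightarrow> val x = val y"
  by (simp add: word_kernel_def word_value_diff M.minus_eq_zero_iff word_value_closed keys_diff_subset)

text \<open>Evaluation turns prepending into the action on \<open>M\<close>, so every defining relation of a module holds
modulo the kernel because it holds in \<open>M\<close>.\<close>

lemma word_congruence_word_kernel:
  "word_congruence K R \<Omega> lam P (carrier M) (word_kernel R \<Omega> M mop)"
proof -
  have "frag_subgroup gens (word_kernel R \<Omega> M mop)"
    unfolding word_kernel_def by (rule M.frag_subgroup_kernel[OF word_value_hom])
  moreover have "word_congruence_axioms K R \<Omega> lam P (carrier M) (word_kernel R \<Omega> M mop)"
  proof
    fix l x assume l: "l \<in> letters R \<Omega>" and x: "x \<in> word_kernel R \<Omega> M mop"
    have "letter_act M mop l \<zero>\<^bsub>M\<^esub> = \<zero>\<^bsub>M\<^esub>"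
      using hom_one[OF letter_act_hom[OF l]] M.a_group by simp
    then show "prepend l x \<in> word_kernel R \<Omega> M mop"
      using l x by (simp add: word_kernel_def word_value_prepend keys_prepend)
  next
    fix x :: "(('r + 'w) list \<times> 'm) \<Rightarrow>\<^sub>0 int" assume x: "Poly_Mapping.keys x \<subseteq> gens"
    note simps = x word_kernel_iff keys_prepend keys_add_subset word_value_add word_value_prepend
      InlI InrI letter_act_def word_value_closed
    show "prepend (Inl \<one>\<^bsub>R\<^esub>) x - x \<in> word_kernel R \<Omega> M mop"
      by (simp add: simps lact_one)
    fix a assume a: "a \<in> carrier R"
    {
      fix b assume b: "b \<in> carrier R"
      show "prepend (Inl (a \<oplus>\<^bsub>R\<^esub> b)) x - (prepend (Inl a) x + prepend (Inl b) x)
          \<in> word_kernel R \<Omega> M mop"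
        using a b by (simp add: simps lact_l_distr)
      show "prepend (Inl (a \<otimes>\<^bsub>R\<^esub> b)) x - prepend (Inl a) (prepend (Inl b) x)
          \<in> word_kernel R \<Omega> M mop"
        using a b by (simp add: simps lact_assoc)
    }
    fix \<alpha> assume \<alpha>: "\<alpha> \<in> \<Omega>"
    fix \<beta> assume \<beta>: "\<beta> \<in> \<Omega>"
    show "prepend (Inl (P \<alpha> a)) (prepend (Inr \<beta>) x)
      - (prepend (Inr \<alpha>) (prepend (Inl a) (prepend (Inr \<beta>) x))
        + prepend (Inr \<beta>) (prepend (Inl (P \<alpha> a)) x)
        + prepend (Inl (lam \<beta> \<odot>\<^bsub>R\<^esub> \<one>\<^bsub>R\<^esub>)) (prepend (Inr \<alpha>) (prepend (Inl a) x))
        + prepend (Inl (lam \<alpha> \<odot>\<^bsub>R\<^esub> \<one>\<^bsub>R\<^esub>)) (prepend (Inr \<beta>) (prepend (Inl a) x)))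
      \<in> word_kernel R \<Omega> M mop"
      using a \<alpha> \<beta> mop_rota_baxter[of \<alpha> \<beta> a "val x"]
      by (simp add: simps weight_closed P_closed lscal_def)
  next
    fix x :: "(('r + 'w) list \<times> 'm) \<Rightarrow>\<^sub>0 int" and \<alpha> c assume x: "Poly_Mapping.keys x \<subseteq> gens" and "\<alpha> \<in> \<Omega>" "c \<in> carrier K"
    then show "prepend (Inr \<alpha>) (prepend (Inl (c \<odot>\<^bsub>R\<^esub> \<one>\<^bsub>R\<^esub>)) x)
      - prepend (Inl (c \<odot>\<^bsub>R\<^esub> \<one>\<^bsub>R\<^esub>)) (prepend (Inr \<alpha>) x) \<in> word_kernel R \<Omega> M mop"
      using mop_scal[of \<alpha> c "val x"]
      by (simp add: word_kernel_iff keys_prepend word_value_prepend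
      InlI InrI letter_act_def word_value_closed lscal_def)
  qed
  ultimately show ?thesis
    by (simp add: word_congruence_def A.mrb_algebra_axioms)
qed

end

section \<open>Words acting on a right module\<close>

definition letter_ract :: "('r, 's, 'z) rmodule_scheme \<Rightarrow> ('w \<Rightarrow> 's \<Rightarrow> 's) \<Rightarrow> 's \<Rightarrow> 'r + 'w \<Rightarrow> 's"
  where "letter_ract S sop b l = (case l of Inl r \<Rightarrow> b \<oslash>\<^bsub>S\<^esub> r | Inr \<omega> \<Rightarrow> sop \<omega> b)"

text \<open>For the free module with basis \<open>t \<in> E\<close> over the ring generated by the letters, \<open>b \<otimes> (\<Sum>\<^sub>t u\<^sub>t \<cdot> t)\<close>
is determined by the elements \<open>b \<cdot> u\<^sub>t\<close>. The combination \<open>spread S sop b x\<close> represents the family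
of these elements for a combination of words \<open>x\<close>; \<open>coordinate\<close> reads off its member at \<open>t\<close>.\<close>

definition spread :: "('r, 's, 'z) rmodule_scheme \<Rightarrow> ('w \<Rightarrow> 's \<Rightarrow> 's) \<Rightarrow> 's \<Rightarrow>
    ((('r + 'w) list \<times> 'm) \<Rightarrow>\<^sub>0 int) \<Rightarrow> (('s \<times> 'm) \<Rightarrow>\<^sub>0 int)"
  where "spread S sop b = frag_extend (\<lambda>(w, x). frag_of (foldl (letter_ract S sop) b w, x))"

definition coordinate :: "('r, 's, 'z) rmodule_scheme \<Rightarrow> 'm set \<Rightarrow> 'm \<Rightarrow> (('s \<times> 'm) \<Rightarrow>\<^sub>0 int) \<Rightarrow> 's"
  where "coordinate S E t =
    linear_extension (carrier S \<times> E) S (\<lambda>(b, x). if x = t then b else \<zero>\<^bsub>S\<^esub>)"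

text \<open>The kernel of the map from formal combinations of pairs to the direct sum of copies of \<open>S\<close> indexed by \<open>E\<close>.\<close>

definition zero_coordinates :: "('r, 's, 'z) rmodule_scheme \<Rightarrow> 'm set \<Rightarrow> (('s \<times> 'm) \<Rightarrow>\<^sub>0 int) set"
  where "zero_coordinates S E =
    {z. Poly_Mapping.keys z \<subseteq> carrier S \<times> E \<and> (\<forall>t\<in>E. coordinate S E t z = \<zero>\<^bsub>S\<^esub>)}"

definition spread_kernel :: "('k, 'r, 'y) module_scheme \<Rightarrow> 'w set \<Rightarrow>
    ('r, 's, 'z) rmodule_scheme \<Rightarrow> ('w \<Rightarrow> 's \<Rightarrow> 's) \<Rightarrow> 'm set \<Rightarrow> ((('r + 'w) list \<times> 'm) \<Rightarrow>\<^sub>0 int) set"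
  where "spread_kernel R \<Omega> S sop E = {x. Poly_Mapping.keys x \<subseteq> word_gens R \<Omega> E \<and>
    (\<forall>b\<in>carrier S. spread S sop b x \<in> zero_coordinates S E)}"

lemma spread_zero: "spread S sop b 0 = 0"
  by (simp add: spread_def)

lemma spread_diff: "spread S sop b (x - y) = spread S sop b x - spread S sop b y"
  by (simp add: spread_def frag_extend_diff)

lemma spread_add: "spread S sop b (x + y) = spread S sop b x + spread S sop b y"
  by (simp add: spread_def frag_extend_add)

lemma spread_of [simp]:
  "spread S sop b (frag_of (w, x)) = frag_of (foldl (letter_ract S sop) b w, x)"
  by (simp add: spread_def)

lemma spread_prepend: "spread S sop b (prepend l x) = spread S sop (letter_ract S sop b l) x"
proof (rule frag_induction[of x UNIV])
  show "spread S sop b (prepend l 0) = spread S sop (letter_ract S sop b l) 0"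
    by (simp add: spread_def prepend_def)
qed (auto simp: prepend_diff spread_diff)

context right_mrb_module
begin

lemma coordinate_hom: "coordinate S E t \<in> hom (free_Abelian_group (carrier S \<times> E)) (add_monoid S)"
  and coordinate_of: "b \<in> carrier S \<Longrightarrow> x \<in> E \<Longrightarrow>
    coordinate S E t (frag_of (b, x)) = (if x = t then b else \<zero>\<^bsub>S\<^esub>)"
proof -
  have *: "(\<lambda>(b, x). if x = t then b else \<zero>\<^bsub>S\<^esub>) ` (carrier S \<times> E) \<subseteq> carrier S"
    by auto
  show "coordinate S E t \<in> hom (free_Abelian_group (carrier S \<times> E)) (add_monoid S)"
    unfolding coordinate_def by (rule S.linear_extension(1)[OF *])
  show "coordinate S E t (frag_of (b, x)) = (if x = t then b else \<zero>\<^bsub>S\<^esub>)"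
    if "b \<in> carrier S" "x \<in> E"
    unfolding coordinate_def using that S.linear_extension(2)[OF *, of "(b, x)"] by simp
qed

lemmas coordinate_diff = S.hom_free_diff[OF coordinate_hom]
lemmas coordinate_zero = S.hom_free_zero[OF coordinate_hom]
lemmas coordinate_closed = S.hom_free_closed[OF coordinate_hom]
lemmas coordinate_add = S.hom_free_add[OF coordinate_hom]

lemma frag_subgroup_zero_coordinates:
  "frag_subgroup (carrier S \<times> E) (zero_coordinates S E)"
  by unfold_locales
    (auto simp: zero_coordinates_def coordinate_zero coordinate_diff S.minus_eq_zero_iff
      dest: subsetD[OF keys_diff])

lemma zero_coordinates_add:
  assumes "b \<in> carrier S" "b' \<in> carrier S" "x \<in> E"
  shows "frag_of (b \<oplus>\<^bsub>S\<^esub> b', x) - (frag_of (b, x) + frag_of (b', x)) \<in> zero_coordinates S E"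
  using assms
  by (simp add: zero_coordinates_def keys_diff_subset keys_add_subset coordinate_diff coordinate_add
      coordinate_of S.minus_eq_zero_iff)

lemma letter_ract_closed:
  "l \<in> letters R \<Omega> \<Longrightarrow> b \<in> carrier S \<Longrightarrow> letter_ract S sop b l \<in> carrier S"
  by (auto simp: letter_ract_def ract_closed sop_closed)

lemma letter_ract_add:
  "l \<in> letters R \<Omega> \<Longrightarrow> b \<in> carrier S \<Longrightarrow> b' \<in> carrier S \<Longrightarrow>
    letter_ract S sop (b \<oplus>\<^bsub>S\<^esub> b') l = letter_ract S sop b l \<oplus>\<^bsub>S\<^esub> letter_ract S sop b' l"
  by (auto simp: letter_ract_def ract_l_distr sop_add)

lemma foldl_letter_ract_closed:
  "w \<in> lists (letters R \<Omega>) \<Longrightarrow> b \<in> carrier S \<Longrightarrow> foldl (letter_ract S sop) b w \<in> carrier S"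
  by (induction w arbitrary: b) (simp_all add: letter_ract_closed)

lemma foldl_letter_ract_add:
  "w \<in> lists (letters R \<Omega>) \<Longrightarrow> b \<in> carrier S \<Longrightarrow> b' \<in> carrier S \<Longrightarrow>
    foldl (letter_ract S sop) (b \<oplus>\<^bsub>S\<^esub> b') w
      = foldl (letter_ract S sop) b w \<oplus>\<^bsub>S\<^esub> foldl (letter_ract S sop) b' w"
  by (induction w arbitrary: b b') (simp_all add: letter_ract_closed letter_ract_add)

lemma keys_spread:
  assumes "b \<in> carrier S" and "Poly_Mapping.keys x \<subseteq> word_gens R \<Omega> E"
  shows "Poly_Mapping.keys (spread S sop b x) \<subseteq> carrier S \<times> E"
  unfolding spread_def using assms(2)
proof (rule keys_frag_extend_subset)
  fix g assume "g \<in> word_gens R \<Omega> E"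
  then obtain w x where "g = (w, x)" "w \<in> lists (letters R \<Omega>)" "x \<in> E"
    unfolding word_gens_def by blast
  then show "Poly_Mapping.keys (case g of (w, x) \<Rightarrow> frag_of (foldl (letter_ract S sop) b w, x))
      \<subseteq> carrier S \<times> E"
    using foldl_letter_ract_closed[OF _ assms(1)] by simp
qed

lemma spread_add_left:
  assumes b: "b \<in> carrier S" "b' \<in> carrier S" and x: "Poly_Mapping.keys x \<subseteq> word_gens R \<Omega> E"
  shows "spread S sop (b \<oplus>\<^bsub>S\<^esub> b') x - (spread S sop b x + spread S sop b' x) \<in> zero_coordinates S E"
proof -
  interpret D: frag_subgroup "carrier S \<times> E" "zero_coordinates S E"
    by (rule frag_subgroup_zero_coordinates)
  show ?thesis
    using x
  proof (rule free_Abelian_group_induct)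
    show "spread S sop (b \<oplus>\<^bsub>S\<^esub> b') 0 - (spread S sop b 0 + spread S sop b' 0) \<in> zero_coordinates S E"
      by (simp add: spread_def)
  next
    fix x y
    assume "spread S sop (b \<oplus>\<^bsub>S\<^esub> b') x - (spread S sop b x + spread S sop b' x) \<in> zero_coordinates S E"
      "spread S sop (b \<oplus>\<^bsub>S\<^esub> b') y - (spread S sop b y + spread S sop b' y) \<in> zero_coordinates S E"
    from D.diff_mem[OF this]
    show "spread S sop (b \<oplus>\<^bsub>S\<^esub> b') (x - y) - (spread S sop b (x - y) + spread S sop b' (x - y))
        \<in> zero_coordinates S E"
      by (simp add: spread_diff algebra_simps)
  next
    fix g assume "g \<in> word_gens R \<Omega> E"
    then obtain w x where "g = (w, x)" "w \<in> lists (letters R \<Omega>)" "x \<in> E"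
      unfolding word_gens_def by blast
    then show "spread S sop (b \<oplus>\<^bsub>S\<^esub> b') (frag_of g) - (spread S sop b (frag_of g) + spread S sop b' (frag_of g))
        \<in> zero_coordinates S E"
      using b zero_coordinates_add[OF foldl_letter_ract_closed foldl_letter_ract_closed]
      by (simp add: foldl_letter_ract_add del: in_lists_conv_set)
  qed
qed

text \<open>In the identity for \<open>sop\<close> the scalars act last, in the words that express the identity for left
modules they are the first letter. The two agree because scalars are central in \<open>R\<close>.\<close>

lemma rscal_commute:
  assumes "c \<in> carrier K" "a \<in> carrier R" "b \<in> carrier S"
  shows "(b \<oslash>\<^bsub>S\<^esub> (c \<odot>\<^bsub>R\<^esub> \<one>\<^bsub>R\<^esub>)) \<oslash>\<^bsub>S\<^esub> a = rscal R S c (b \<oslash>\<^bsub>S\<^esub> a)"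
proof -
  have c: "c \<odot>\<^bsub>R\<^esub> \<one>\<^bsub>R\<^esub> \<in> carrier R" using assms by simp
  have "(c \<odot>\<^bsub>R\<^esub> \<one>\<^bsub>R\<^esub>) \<otimes>\<^bsub>R\<^esub> a = a \<otimes>\<^bsub>R\<^esub> (c \<odot>\<^bsub>R\<^esub> \<one>\<^bsub>R\<^esub>)"
    using assms by (simp add: smult_mult_left smult_mult_right)
  then show ?thesis
    using assms c by (simp add: rscal_def ract_assoc[symmetric])
qed

text \<open>Prepending a letter \<open>l\<close> to a word amounts to replacing \<open>b\<close> by \<open>b \<cdot> l\<close> (\<open>spread_prepend\<close>), so a
defining relation of left modules holds modulo this subgroup because the relation of right modules with
the factors in the same order holds for \<open>b\<close>. The Rota-Baxter identities for left and right modules are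
indeed one relation, read from the two sides.\<close>

lemma word_congruence_spread_kernel:
  fixes E :: "'m set"
  shows "word_congruence K R \<Omega> lam P E (spread_kernel R \<Omega> S sop E)"
proof -
  interpret D: frag_subgroup "carrier S \<times> E" "zero_coordinates S E"
    by (rule frag_subgroup_zero_coordinates)
  have "frag_subgroup (word_gens R \<Omega> E) (spread_kernel R \<Omega> S sop E)"
    by unfold_locales
      (auto simp: spread_kernel_def spread_diff D.diff_mem spread_zero
        dest: subsetD[OF keys_diff])
  moreover have "word_congruence_axioms K R \<Omega> lam P E (spread_kernel R \<Omega> S sop E)"
  proof
    fix l x assume l: "l \<in> letters R \<Omega>" and x: "x \<in> spread_kernel R \<Omega> S sop E"
    then show "prepend l x \<in> spread_kernel R \<Omega> S sop E"
      by (simp add: spread_kernel_def keys_prepend spread_prepend letter_ract_closed)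
  next
    fix x :: "(('r + 'w) list \<times> 'm) \<Rightarrow>\<^sub>0 int" assume x: "Poly_Mapping.keys x \<subseteq> word_gens R \<Omega> E"
    note simps = x spread_kernel_def keys_prepend keys_add_subset keys_diff_subset spread_add
      spread_diff spread_prepend InlI InrI letter_ract_def
    show "prepend (Inl \<one>\<^bsub>R\<^esub>) x - x \<in> spread_kernel R \<Omega> S sop E"
      by (simp add: simps ract_one)
    fix a assume a: "a \<in> carrier R"
    {
      fix b assume b: "b \<in> carrier R"
      show "prepend (Inl (a \<oplus>\<^bsub>R\<^esub> b)) x - (prepend (Inl a) x + prepend (Inl b) x)
          \<in> spread_kernel R \<Omega> S sop E"
        using a b by (simp add: simps ract_r_distr spread_add_left ract_closed)
      show "prepend (Inl (a \<otimes>\<^bsub>R\<^esub> b)) x - prepend (Inl a) (prepend (Inl b) x)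
          \<in> spread_kernel R \<Omega> S sop E"
        using a b by (simp add: simps ract_assoc)
    }
    fix \<alpha> assume \<alpha>: "\<alpha> \<in> \<Omega>"
    fix \<beta> assume \<beta>: "\<beta> \<in> \<Omega>"
    have "spread S sop (sop \<beta> (b \<oslash>\<^bsub>S\<^esub> P \<alpha> a)) x
      - (spread S sop (sop \<beta> (sop \<alpha> b \<oslash>\<^bsub>S\<^esub> a)) x + spread S sop (sop \<beta> b \<oslash>\<^bsub>S\<^esub> P \<alpha> a) x
        + spread S sop (sop \<alpha> (b \<oslash>\<^bsub>S\<^esub> (lam \<beta> \<odot>\<^bsub>R\<^esub> \<one>\<^bsub>R\<^esub>)) \<oslash>\<^bsub>S\<^esub> a) x
        + spread S sop (sop \<beta> (b \<oslash>\<^bsub>S\<^esub> (lam \<alpha> \<odot>\<^bsub>R\<^esub> \<one>\<^bsub>R\<^esub>)) \<oslash>\<^bsub>S\<^esub> a) x) \<in> zero_coordinates S E"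
      if b: "b \<in> carrier S" for b
    proof -
      let ?b1 = "sop \<beta> (sop \<alpha> b \<oslash>\<^bsub>S\<^esub> a)" and ?b2 = "sop \<beta> b \<oslash>\<^bsub>S\<^esub> P \<alpha> a"
        and ?b3 = "sop \<alpha> (b \<oslash>\<^bsub>S\<^esub> (lam \<beta> \<odot>\<^bsub>R\<^esub> \<one>\<^bsub>R\<^esub>)) \<oslash>\<^bsub>S\<^esub> a"
        and ?b4 = "sop \<beta> (b \<oslash>\<^bsub>S\<^esub> (lam \<alpha> \<odot>\<^bsub>R\<^esub> \<one>\<^bsub>R\<^esub>)) \<oslash>\<^bsub>S\<^esub> a"
      have b3: "?b3 = rscal R S (lam \<beta>) (sop \<alpha> b \<oslash>\<^bsub>S\<^esub> a)"
        using rscal_commute[of "lam \<beta>" a "sop \<alpha> b"] sop_scal[of \<alpha> "lam \<beta>" b] a \<alpha> \<beta> b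
        by (simp add: rscal_def weight_closed sop_closed)
      have b4: "?b4 = rscal R S (lam \<alpha>) (sop \<beta> b \<oslash>\<^bsub>S\<^esub> a)"
        using rscal_commute[of "lam \<alpha>" a "sop \<beta> b"] sop_scal[of \<beta> "lam \<alpha>" b] a \<alpha> \<beta> b
        by (simp add: rscal_def weight_closed sop_closed)
      have eq: "sop \<beta> (b \<oslash>\<^bsub>S\<^esub> P \<alpha> a) = ?b1 \<oplus>\<^bsub>S\<^esub> ?b2 \<oplus>\<^bsub>S\<^esub> ?b3 \<oplus>\<^bsub>S\<^esub> ?b4"
        unfolding b3 b4 using sop_rota_baxter[OF \<alpha> \<beta> a b] .
      have cl: "?b1 \<in> carrier S" "?b2 \<in> carrier S" "?b3 \<in> carrier S" "?b4 \<in> carrier S"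
        using a \<alpha> \<beta> b by (simp_all add: sop_closed ract_closed P_closed weight_closed)
      have "spread S sop (?b1 \<oplus>\<^bsub>S\<^esub> ?b2 \<oplus>\<^bsub>S\<^esub> ?b3 \<oplus>\<^bsub>S\<^esub> ?b4) x
          - (spread S sop (?b1 \<oplus>\<^bsub>S\<^esub> ?b2 \<oplus>\<^bsub>S\<^esub> ?b3) x + spread S sop ?b4 x) \<in> zero_coordinates S E"
        "spread S sop (?b1 \<oplus>\<^bsub>S\<^esub> ?b2 \<oplus>\<^bsub>S\<^esub> ?b3) x
          - (spread S sop (?b1 \<oplus>\<^bsub>S\<^esub> ?b2) x + spread S sop ?b3 x) \<in> zero_coordinates S E"
        "spread S sop (?b1 \<oplus>\<^bsub>S\<^esub> ?b2) x
          - (spread S sop ?b1 x + spread S sop ?b2 x) \<in> zero_coordinates S E"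
        using cl x by (simp_all add: spread_add_left)
      from D.add_mem[OF D.add_mem[OF this(1,2)] this(3)]
      show ?thesis unfolding eq by (simp add: algebra_simps)
    qed
    then show "prepend (Inl (P \<alpha> a)) (prepend (Inr \<beta>) x)
      - (prepend (Inr \<alpha>) (prepend (Inl a) (prepend (Inr \<beta>) x))
        + prepend (Inr \<beta>) (prepend (Inl (P \<alpha> a)) x)
        + prepend (Inl (lam \<beta> \<odot>\<^bsub>R\<^esub> \<one>\<^bsub>R\<^esub>)) (prepend (Inr \<alpha>) (prepend (Inl a) x))
        + prepend (Inl (lam \<alpha> \<odot>\<^bsub>R\<^esub> \<one>\<^bsub>R\<^esub>)) (prepend (Inr \<beta>) (prepend (Inl a) x)))
      \<in> spread_kernel R \<Omega> S sop E"
      using a \<alpha> \<beta> by (simp add: simps weight_closed P_closed)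
  next
    fix x :: "(('r + 'w) list \<times> 'm) \<Rightarrow>\<^sub>0 int" and \<alpha> c assume x: "Poly_Mapping.keys x \<subseteq> word_gens R \<Omega> E" and "\<alpha> \<in> \<Omega>" "c \<in> carrier K"
    then show "prepend (Inr \<alpha>) (prepend (Inl (c \<odot>\<^bsub>R\<^esub> \<one>\<^bsub>R\<^esub>)) x)
      - prepend (Inl (c \<odot>\<^bsub>R\<^esub> \<one>\<^bsub>R\<^esub>)) (prepend (Inr \<alpha>) x) \<in> spread_kernel R \<Omega> S sop E"
      using sop_scal[of \<alpha> c]
      by (simp add: spread_kernel_def keys_prepend keys_diff_subset spread_diff spread_prepend
          InlI InrI letter_ract_def rscal_def)
  qed
  ultimately show ?thesis
    by (simp add: word_congruence_def A.mrb_algebra_axioms)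
qed

end

section \<open>The dual basis of a projective module\<close>

lemma left_mrb_homI:
  assumes "\<And>x. x \<in> carrier M \<Longrightarrow> h x \<in> carrier N"
    and "\<And>x y. x \<in> carrier M \<Longrightarrow> y \<in> carrier M \<Longrightarrow> h (x \<oplus>\<^bsub>M\<^esub> y) = h x \<oplus>\<^bsub>N\<^esub> h y"
    and "\<And>r x. r \<in> carrier R \<Longrightarrow> x \<in> carrier M \<Longrightarrow> h (r \<odot>\<^bsub>M\<^esub> x) = r \<odot>\<^bsub>N\<^esub> h x"
    and "\<And>\<omega> x. \<omega> \<in> \<Omega> \<Longrightarrow> x \<in> carrier M \<Longrightarrow> h (mop \<omega> x) = nop \<omega> (h x)"
  shows "h \<in> left_mrb_hom R \<Omega> M mop N nop"
  using assms by (auto simp: left_mrb_hom_def intro!: homI)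

lemma left_mrb_homD:
  assumes "h \<in> left_mrb_hom R \<Omega> M mop N nop"
  shows "x \<in> carrier M \<Longrightarrow> h x \<in> carrier N"
    and "x \<in> carrier M \<Longrightarrow> y \<in> carrier M \<Longrightarrow> h (x \<oplus>\<^bsub>M\<^esub> y) = h x \<oplus>\<^bsub>N\<^esub> h y"
    and "r \<in> carrier R \<Longrightarrow> x \<in> carrier M \<Longrightarrow> h (r \<odot>\<^bsub>M\<^esub> x) = r \<odot>\<^bsub>N\<^esub> h x"
    and "\<omega> \<in> \<Omega> \<Longrightarrow> x \<in> carrier M \<Longrightarrow> h (mop \<omega> x) = nop \<omega> (h x)"
  using assms by (auto simp: left_mrb_hom_def hom_def)

text \<open>The dual basis: \<open>y x\<close> represents the image of \<open>x\<close> under a section of the epimorphism from the module of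
words modulo \<open>N\<close> onto \<open>M\<close>. The target \<open>M\<close> has to have its elements in the universe that projectivity
speaks about, so the module of words modulo the kernel of the evaluation takes its place.\<close>

lemma projective_section:
  fixes K :: "('k, 'x) ring_scheme" and R :: "('k, 'r, 'y) module_scheme" and \<Omega> :: "'w set"
    and M :: "('r, 'm, 'z) module_scheme"
  assumes proj: "left_mrb_projective TYPE(('r, 'w, 'm) word_universe) K R \<Omega> lam P M mop"
    and N: "word_congruence K R \<Omega> lam P (carrier M) N"
    and sub: "N \<subseteq> word_kernel R \<Omega> M mop"
  obtains y where
    "\<And>x. x \<in> carrier M \<Longrightarrow> Poly_Mapping.keys (y x) \<subseteq> word_gens R \<Omega> (carrier M)"
    and "\<And>x. x \<in> carrier M \<Longrightarrow> word_value R \<Omega> M mop (y x) = x"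
    and "\<And>x x'. x \<in> carrier M \<Longrightarrow> x' \<in> carrier M \<Longrightarrow> y (x \<oplus>\<^bsub>M\<^esub> x') - (y x + y x') \<in> N"
    and "\<And>r x. r \<in> carrier R \<Longrightarrow> x \<in> carrier M \<Longrightarrow> y (r \<odot>\<^bsub>M\<^esub> x) - prepend (Inl r) (y x) \<in> N"
    and "\<And>\<omega> x. \<omega> \<in> \<Omega> \<Longrightarrow> x \<in> carrier M \<Longrightarrow> y (mop \<omega> x) - prepend (Inr \<omega>) (y x) \<in> N"
proof -
  interpret M: left_mrb_module K R \<Omega> lam P M mop
    using proj by (simp add: left_mrb_projective_def)
  interpret N: word_congruence K R \<Omega> lam P "carrier M" N by fact
  interpret V: word_congruence K R \<Omega> lam P "carrier M" "word_kernel R \<Omega> M mop"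
    by (rule M.word_congruence_word_kernel)
  let ?\<theta> = "\<lambda>U. word_kernel R \<Omega> M mop <#>\<^bsub>free_Abelian_group M.gens\<^esub> (\<lambda>x. x) ` U"
  let ?\<phi> = "\<lambda>x. V.cls (frag_of ([], x))"
  have \<theta>: "?\<theta> (N.cls x) = V.cls x" for x
    by (rule V.induced_cls[OF N.frag_subgroup_axioms]) (use sub in auto)
  have \<theta>_hom: "?\<theta> \<in> left_mrb_hom R \<Omega> N.F N.fop V.F V.fop"
  proof (rule left_mrb_homI)
    fix U assume "U \<in> carrier N.F"
    then obtain x where x: "U = N.cls x" "Poly_Mapping.keys x \<subseteq> M.gens"
      by (auto simp: N.carrier_word_module)
    show "?\<theta> U \<in> carrier V.F"
      unfolding x(1) \<theta> by (rule V.cls_in_word_module[OF x(2)])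
    show "?\<theta> (r \<odot>\<^bsub>N.F\<^esub> U) = r \<odot>\<^bsub>V.F\<^esub> ?\<theta> U" if "r \<in> carrier R" for r
      unfolding x(1) using that by (simp only: N.smult_word_module V.smult_word_module \<theta>)
    show "?\<theta> (N.fop \<omega> U) = V.fop \<omega> (?\<theta> U)" if "\<omega> \<in> \<Omega>" for \<omega>
      unfolding x(1) using that by (simp only: N.op_word_module V.op_word_module \<theta>)
    fix U' assume "U' \<in> carrier N.F"
    then obtain x' where x': "U' = N.cls x'"
      by (auto simp: N.carrier_word_module)
    show "?\<theta> (U \<oplus>\<^bsub>N.F\<^esub> U') = ?\<theta> U \<oplus>\<^bsub>V.F\<^esub> ?\<theta> U'"
      unfolding x(1) x' by (simp only: N.add_word_module V.add_word_module \<theta>)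
  qed
  have surj: "?\<theta> ` carrier N.F = carrier V.F"
    unfolding N.carrier_word_module V.carrier_word_module image_image \<theta> ..
  have gens: "([], x) \<in> M.gens" if "x \<in> carrier M" for x
    using that by (simp add: word_gens_def)
  have \<phi>_hom: "?\<phi> \<in> left_mrb_hom R \<Omega> M mop V.F V.fop"
  proof (rule left_mrb_homI)
    fix x assume x: "x \<in> carrier M"
    show "?\<phi> x \<in> carrier V.F"
      by (rule V.cls_in_word_module) (use gens[OF x] in simp)
    show "?\<phi> (r \<odot>\<^bsub>M\<^esub> x) = r \<odot>\<^bsub>V.F\<^esub> ?\<phi> x" if r: "r \<in> carrier R" for r
    proof -
      have "([Inl r], x) \<in> M.gens"
        using x r by (simp add: word_gens_def InlI)
      then show ?thesis
        using x r gens[of x] gens[of "r \<odot>\<^bsub>M\<^esub> x"]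
        by (simp add: V.smult_word_module V.cls_eq_iff M.word_kernel_iff M.word_value_of
            M.lact_closed letter_act_def)
    qed
    show "?\<phi> (mop \<omega> x) = V.fop \<omega> (?\<phi> x)" if \<omega>: "\<omega> \<in> \<Omega>" for \<omega>
    proof -
      have "([Inr \<omega>], x) \<in> M.gens"
        using x \<omega> by (simp add: word_gens_def InrI)
      then show ?thesis
        using x \<omega> gens[of x] gens[of "mop \<omega> x"]
        by (simp add: V.op_word_module V.cls_eq_iff M.word_kernel_iff M.word_value_of
            M.mop_closed letter_act_def)
    qed
    fix x' assume x': "x' \<in> carrier M"
    show "?\<phi> (x \<oplus>\<^bsub>M\<^esub> x') = ?\<phi> x \<oplus>\<^bsub>V.F\<^esub> ?\<phi> x'"
      using x x' gens[of x] gens[of x'] gens[of "x \<oplus>\<^bsub>M\<^esub> x'"]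
      by (simp add: V.add_word_module V.cls_eq_iff M.word_kernel_iff M.word_value_of
          M.word_value_add keys_add_subset)
  qed
  have "\<exists>\<psi> \<in> left_mrb_hom R \<Omega> M mop N.F N.fop. \<forall>x\<in>carrier M. ?\<phi> x = ?\<theta> (\<psi> x)"
    using proj N.left_mrb_module_word_module V.left_mrb_module_word_module \<theta>_hom surj \<phi>_hom
    unfolding left_mrb_projective_def by blast
  then obtain \<psi> where \<psi>: "\<psi> \<in> left_mrb_hom R \<Omega> M mop N.F N.fop"
    and \<psi>_sec: "\<And>x. x \<in> carrier M \<Longrightarrow> ?\<phi> x = ?\<theta> (\<psi> x)"
    by blast
  have "\<exists>z. \<psi> x = N.cls z \<and> Poly_Mapping.keys z \<subseteq> M.gens" if "x \<in> carrier M" for x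
    using left_mrb_homD(1)[OF \<psi> that] by (auto simp: N.carrier_word_module)
  then obtain y where y: "\<And>x. x \<in> carrier M \<Longrightarrow> \<psi> x = N.cls (y x)"
    and keys: "\<And>x. x \<in> carrier M \<Longrightarrow> Poly_Mapping.keys (y x) \<subseteq> M.gens"
    by metis
  show thesis
  proof (rule that[of y])
    fix x assume x: "x \<in> carrier M"
    show "Poly_Mapping.keys (y x) \<subseteq> M.gens" using keys[OF x] .
    have "V.cls (frag_of ([], x)) = V.cls (y x)"
      using \<psi>_sec[OF x] unfolding y[OF x] \<theta> .
    then show "M.val (y x) = x"
      using x keys[OF x] gens[OF x] by (simp add: V.cls_eq_iff M.word_kernel_iff M.word_value_of)
    show "y (r \<odot>\<^bsub>M\<^esub> x) - prepend (Inl r) (y x) \<in> N" if r: "r \<in> carrier R" for r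
      using left_mrb_homD(3)[OF \<psi> r x] y[of x] y[of "r \<odot>\<^bsub>M\<^esub> x"] r x
      by (simp add: M.lact_closed N.smult_word_module N.cls_eq_iff)
    show "y (mop \<omega> x) - prepend (Inr \<omega>) (y x) \<in> N" if \<omega>: "\<omega> \<in> \<Omega>" for \<omega>
      using left_mrb_homD(4)[OF \<psi> \<omega> x] y[of x] y[of "mop \<omega> x"] \<omega> x
      by (simp add: M.mop_closed N.op_word_module N.cls_eq_iff)
    fix x' assume x': "x' \<in> carrier M"
    show "y (x \<oplus>\<^bsub>M\<^esub> x') - (y x + y x') \<in> N"
      using left_mrb_homD(2)[OF \<psi> x x'] y[of x] y[of x'] y[of "x \<oplus>\<^bsub>M\<^esub> x'"] x x'
      by (simp add: N.add_word_module N.cls_eq_iff)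
  qed
qed

section \<open>Congruences in a tensor product\<close>

locale mrb_pair =
  L: left_mrb_module K R \<Omega> lam P M mop + T: right_mrb_module K R \<Omega> lam P S sop
  for K :: "('k, 'x) ring_scheme" and R :: "('k, 'r, 'y) module_scheme"
    and \<Omega> :: "'w set" and lam :: "'w \<Rightarrow> 'k" and P :: "'w \<Rightarrow> 'r \<Rightarrow> 'r"
    and M :: "('r, 'm, 'z) module_scheme" and mop :: "'w \<Rightarrow> 'm \<Rightarrow> 'm"
    and S :: "('r, 's, 'u) rmodule_scheme" and sop :: "'w \<Rightarrow> 's \<Rightarrow> 's"
begin

abbreviation rel :: "(('s \<times> 'm) \<Rightarrow>\<^sub>0 int) set"
  where "rel \<equiv> tensor_relations R \<Omega> S sop M mop"

lemma frag_subgroup_rel: "frag_subgroup (carrier S \<times> carrier M) rel"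
proof -
  have "subgroup rel (free_Abelian_group (carrier S \<times> carrier M))"
    unfolding tensor_relations_def tensor_generators_def
    by (rule group.generate_is_subgroup)
      (auto dest!: subsetD[OF keys_diff] simp: L.lact_closed L.mop_closed T.ract_closed T.sop_closed)
  then show ?thesis
    by (smt (verit, best) carrier_free_Abelian_group_iff diff_conv_add_uminus frag_subgroup.intro
        inv_free_Abelian_group mult_free_Abelian_group one_free_Abelian_group subgroup.m_closed
        subgroup.m_inv_closed subgroup.mem_carrier subgroup.one_closed)
qed

sublocale rel: frag_subgroup "carrier S \<times> carrier M" rel
  by (rule frag_subgroup_rel)

lemma rel_add_left: "\<lbrakk>s \<in> carrier S; s' \<in> carrier S; m \<in> carrier M\<rbrakk> \<Longrightarrow>
    frag_of (s \<oplus>\<^bsub>S\<^esub> s', m) - (frag_of (s, m) + frag_of (s', m)) \<in> rel"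
  unfolding tensor_relations_def diff_diff_eq[symmetric] by (rule generate.incl) blast

lemma rel_add_right: "\<lbrakk>s \<in> carrier S; m \<in> carrier M; m' \<in> carrier M\<rbrakk> \<Longrightarrow>
    frag_of (s, m \<oplus>\<^bsub>M\<^esub> m') - (frag_of (s, m) + frag_of (s, m')) \<in> rel"
  unfolding tensor_relations_def diff_diff_eq[symmetric] by (rule generate.incl) blast

lemma rel_act: "\<lbrakk>s \<in> carrier S; r \<in> carrier R; m \<in> carrier M\<rbrakk> \<Longrightarrow>
    frag_of (s \<oslash>\<^bsub>S\<^esub> r, m) - frag_of (s, r \<odot>\<^bsub>M\<^esub> m) \<in> rel"
  unfolding tensor_relations_def by (rule generate.incl) blast

lemma rel_op: "\<lbrakk>\<omega> \<in> \<Omega>; s \<in> carrier S; m \<in> carrier M\<rbrakk> \<Longrightarrow>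
    frag_of (sop \<omega> s, m) - frag_of (s, mop \<omega> m) \<in> rel"
  unfolding tensor_relations_def by (rule generate.incl) blast

text \<open>The universal property of the tensor product, for additive maps on the level of representatives.\<close>

lemma rel_image_subset:
  assumes "frag_subgroup Y N"
    and diff: "\<And>x y. h (x - y) = h x - h y"
    and add_left: "\<And>s s' m. \<lbrakk>s \<in> carrier S; s' \<in> carrier S; m \<in> carrier M\<rbrakk> \<Longrightarrow>
      h (frag_of (s \<oplus>\<^bsub>S\<^esub> s', m)) - (h (frag_of (s, m)) + h (frag_of (s', m))) \<in> N"
    and add_right: "\<And>s m m'. \<lbrakk>s \<in> carrier S; m \<in> carrier M; m' \<in> carrier M\<rbrakk> \<Longrightarrow>
      h (frag_of (s, m \<oplus>\<^bsub>M\<^esub> m')) - (h (frag_of (s, m)) + h (frag_of (s, m'))) \<in> N"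
    and act: "\<And>s r m. \<lbrakk>s \<in> carrier S; r \<in> carrier R; m \<in> carrier M\<rbrakk> \<Longrightarrow>
      h (frag_of (s \<oslash>\<^bsub>S\<^esub> r, m)) - h (frag_of (s, r \<odot>\<^bsub>M\<^esub> m)) \<in> N"
    and op: "\<And>\<omega> s m. \<lbrakk>\<omega> \<in> \<Omega>; s \<in> carrier S; m \<in> carrier M\<rbrakk> \<Longrightarrow>
      h (frag_of (sop \<omega> s, m)) - h (frag_of (s, mop \<omega> m)) \<in> N"
  shows "h ` rel \<subseteq> N"
proof -
  interpret N: frag_subgroup Y N by fact
  have zero: "h 0 = 0" using diff[of 0 0] by simp
  have sum: "h (x + y) = h x + h y" for x y
    using diff[of x "0 - y"] diff[of 0 y] zero by simp
  let ?G = "{frag_of (s \<oplus>\<^bsub>S\<^esub> s', m) - frag_of (s, m) - frag_of (s', m) | s s' m.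
        s \<in> carrier S \<and> s' \<in> carrier S \<and> m \<in> carrier M} \<union>
     {frag_of (s, m \<oplus>\<^bsub>M\<^esub> m') - frag_of (s, m) - frag_of (s, m') | s m m'.
        s \<in> carrier S \<and> m \<in> carrier M \<and> m' \<in> carrier M} \<union>
     {frag_of (s \<oslash>\<^bsub>S\<^esub> r, m) - frag_of (s, r \<odot>\<^bsub>M\<^esub> m) | s r m.
        s \<in> carrier S \<and> r \<in> carrier R \<and> m \<in> carrier M} \<union>
     {frag_of (sop \<omega> s, m) - frag_of (s, mop \<omega> m) | \<omega> s m.
        \<omega> \<in> \<Omega> \<and> s \<in> carrier S \<and> m \<in> carrier M}"
  have gen: "h g \<in> N" if "g \<in> ?G" for g
    using that
    by (elim UnE CollectE exE conjE)
      (simp_all add: diff sum diff_diff_eq add_left add_right act op)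
  have "h x \<in> N" if "x \<in> rel" for x
    using that unfolding tensor_relations_def
  proof (induction x rule: generate.induct)
    case one
    show ?case by (simp add: tensor_generators_def zero)
  next
    case (incl g)
    then show ?case by (rule gen)
  next
    case (inv g)
    have "g \<in> rel"
      unfolding tensor_relations_def using inv by (rule generate.incl)
    then have "inv\<^bsub>tensor_generators S M\<^esub> g = 0 - g"
      using rel.keys_mem by (simp add: tensor_generators_def)
    then show ?case
      using N.uminus_mem[OF gen[OF inv]] by (simp only: diff zero) simp
  next
    case (eng x y)
    then show ?case
      using N.add_mem by (simp add: tensor_generators_def sum)
  qed
  then show ?thesis by blast
qed

lemma rel_zero_left: "m \<in> carrier M \<Longrightarrow> frag_of (\<zero>\<^bsub>S\<^esub>, m) \<in> rel"
  using rel.uminus_mem[OF rel_add_left[of "\<zero>\<^bsub>S\<^esub>" "\<zero>\<^bsub>S\<^esub>" m]] by simp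

lemma rel_diff_left:
  assumes "s \<in> carrier S" "s' \<in> carrier S" "m \<in> carrier M"
  shows "frag_of (s \<ominus>\<^bsub>S\<^esub> s', m) - (frag_of (s, m) - frag_of (s', m)) \<in> rel"
proof -
  have "(s \<ominus>\<^bsub>S\<^esub> s') \<oplus>\<^bsub>S\<^esub> s' = s"
    using assms by (simp add: T.S.minus_eq T.S.a_assoc T.S.l_neg)
  then show ?thesis
    using rel.uminus_mem[OF rel_add_left[of "s \<ominus>\<^bsub>S\<^esub> s'" s' m]] assms
    by (simp add: algebra_simps)
qed

lemma rel_diff_right:
  assumes "s \<in> carrier S" "m \<in> carrier M" "m' \<in> carrier M"
  shows "frag_of (s, m \<ominus>\<^bsub>M\<^esub> m') - (frag_of (s, m) - frag_of (s, m')) \<in> rel"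
proof -
  have "(m \<ominus>\<^bsub>M\<^esub> m') \<oplus>\<^bsub>M\<^esub> m' = m"
    using assms by (simp add: L.M.minus_eq L.M.a_assoc L.M.l_neg)
  then show ?thesis
    using rel.uminus_mem[OF rel_add_right[of s "m \<ominus>\<^bsub>M\<^esub> m'" m']] assms
    by (simp add: algebra_simps)
qed

lemma rel_zero_right: "s \<in> carrier S \<Longrightarrow> frag_of (s, \<zero>\<^bsub>M\<^esub>) \<in> rel"
  using rel.uminus_mem[OF rel_add_right[of s "\<zero>\<^bsub>M\<^esub>" "\<zero>\<^bsub>M\<^esub>"]] by simp

abbreviation coord where "coord \<equiv> coordinate S (carrier M)"

text \<open>Additivity in the left factor collects the terms of \<open>z\<close> with the same right factor. The set of right
factors may be enlarged freely, which lets the expansions of two combinations be subtracted.\<close>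

lemma coordinate_expansion:
  assumes "Poly_Mapping.keys z \<subseteq> carrier S \<times> carrier M"
  shows "\<exists>E. finite E \<and> E \<subseteq> carrier M \<and>
    (\<forall>E'. finite E' \<longrightarrow> E \<subseteq> E' \<longrightarrow> E' \<subseteq> carrier M \<longrightarrow> z - (\<Sum>t\<in>E'. frag_of (coord t z, t)) \<in> rel)"
  using assms
proof (rule free_Abelian_group_induct)
  have "0 - (\<Sum>t\<in>E. frag_of (coord t 0, t)) \<in> rel" if "E \<subseteq> carrier M" for E
    using that by (intro rel.diff_mem rel.zero_mem rel.sum_mem)
      (auto simp: T.coordinate_zero rel_zero_left)
  then show "\<exists>E. finite E \<and> E \<subseteq> carrier M \<and>
    (\<forall>E'. finite E' \<longrightarrow> E \<subseteq> E' \<longrightarrow> E' \<subseteq> carrier M \<longrightarrow> 0 - (\<Sum>t\<in>E'. frag_of (coord t 0, t)) \<in> rel)"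
    by blast
next
  fix x y :: "('s \<times> 'm) \<Rightarrow>\<^sub>0 int"
  assume keys: "Poly_Mapping.keys x \<subseteq> carrier S \<times> carrier M" "Poly_Mapping.keys y \<subseteq> carrier S \<times> carrier M"
  assume "\<exists>E. finite E \<and> E \<subseteq> carrier M \<and>
    (\<forall>E'. finite E' \<longrightarrow> E \<subseteq> E' \<longrightarrow> E' \<subseteq> carrier M \<longrightarrow> x - (\<Sum>t\<in>E'. frag_of (coord t x, t)) \<in> rel)"
    and "\<exists>E. finite E \<and> E \<subseteq> carrier M \<and>
    (\<forall>E'. finite E' \<longrightarrow> E \<subseteq> E' \<longrightarrow> E' \<subseteq> carrier M \<longrightarrow> y - (\<Sum>t\<in>E'. frag_of (coord t y, t)) \<in> rel)"
  then obtain E1 E2 where E: "finite E1" "E1 \<subseteq> carrier M" "finite E2" "E2 \<subseteq> carrier M"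
    and E1: "\<And>E'. \<lbrakk>finite E'; E1 \<subseteq> E'; E' \<subseteq> carrier M\<rbrakk> \<Longrightarrow> x - (\<Sum>t\<in>E'. frag_of (coord t x, t)) \<in> rel"
    and E2: "\<And>E'. \<lbrakk>finite E'; E2 \<subseteq> E'; E' \<subseteq> carrier M\<rbrakk> \<Longrightarrow> y - (\<Sum>t\<in>E'. frag_of (coord t y, t)) \<in> rel"
    by blast
  have "(x - y) - (\<Sum>t\<in>E'. frag_of (coord t (x - y), t)) \<in> rel"
    if E': "finite E'" "E1 \<union> E2 \<subseteq> E'" "E' \<subseteq> carrier M" for E'
  proof -
    have "(\<Sum>t\<in>E'. frag_of (coord t (x - y), t) - (frag_of (coord t x, t) - frag_of (coord t y, t))) \<in> rel"
      using keys E' by (intro rel.sum_mem)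
        (auto simp: T.coordinate_diff intro!: rel_diff_left T.coordinate_closed)
    from rel.diff_mem[OF rel.diff_mem[OF E1[of E'] E2[of E']] this]
    show ?thesis
      using E' by (simp add: sum_subtractf sum.distrib algebra_simps)
  qed
  then show "\<exists>E. finite E \<and> E \<subseteq> carrier M \<and>
    (\<forall>E'. finite E' \<longrightarrow> E \<subseteq> E' \<longrightarrow> E' \<subseteq> carrier M \<longrightarrow>
      (x - y) - (\<Sum>t\<in>E'. frag_of (coord t (x - y), t)) \<in> rel)"
    using E by (intro exI[of _ "E1 \<union> E2"]) simp
next
  fix g assume "g \<in> carrier S \<times> carrier M"
  then obtain s m where g: "g = (s, m)" "s \<in> carrier S" "m \<in> carrier M" by blast
  have "frag_of g - (\<Sum>t\<in>E'. frag_of (coord t (frag_of g), t)) \<in> rel"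
    if E': "finite E'" "{m} \<subseteq> E'" "E' \<subseteq> carrier M" for E'
  proof -
    have "(\<Sum>t\<in>E'. frag_of (coord t (frag_of g), t))
        = frag_of g + (\<Sum>t\<in>E' - {m}. frag_of (coord t (frag_of g), t))"
      using E' g by (subst sum.remove[of E' m]) (auto simp: T.coordinate_of)
    moreover have "(\<Sum>t\<in>E' - {m}. frag_of (coord t (frag_of g), t)) \<in> rel"
      using E' g by (intro rel.sum_mem) (auto simp: T.coordinate_of rel_zero_left)
    ultimately show ?thesis
      using rel.uminus_mem by simp
  qed
  then show "\<exists>E. finite E \<and> E \<subseteq> carrier M \<and>
    (\<forall>E'. finite E' \<longrightarrow> E \<subseteq> E' \<longrightarrow> E' \<subseteq> carrier M \<longrightarrow>
      frag_of g - (\<Sum>t\<in>E'. frag_of (coord t (frag_of g), t)) \<in> rel)"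
    using g by (intro exI[of _ "{m}"]) simp
qed

lemma zero_coordinates_subset_rel: "zero_coordinates S (carrier M) \<subseteq> rel"
proof
  fix z assume z: "z \<in> zero_coordinates S (carrier M)"
  then obtain E where E: "E \<subseteq> carrier M" and diff: "z - (\<Sum>t\<in>E. frag_of (coord t z, t)) \<in> rel"
    using coordinate_expansion[of z] by (auto simp: zero_coordinates_def)
  have "(\<Sum>t\<in>E. frag_of (coord t z, t)) \<in> rel"
    using z E
    by (intro rel.sum_mem) (auto simp: zero_coordinates_def rel_zero_left)
  with diff show "z \<in> rel" by (rule rel.cong_mem)
qed

lemma rel_foldr:
  assumes "w \<in> lists (letters R \<Omega>)" "s \<in> carrier S" "m \<in> carrier M"
  shows "frag_of (s, foldr (letter_act M mop) w m) - frag_of (foldl (letter_ract S sop) s w, m) \<in> rel"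
  using assms
proof (induction w arbitrary: s)
  case (Cons l w)
  then have l: "l \<in> letters R \<Omega>" and w: "w \<in> lists (letters R \<Omega>)" by auto
  let ?m = "foldr (letter_act M mop) w m"
  have m: "?m \<in> carrier M" using w Cons.prems by (simp add: L.foldr_letter_act_closed)
  have 1: "frag_of (letter_ract S sop s l, ?m) - frag_of (s, letter_act M mop l ?m) \<in> rel"
    using l m Cons.prems rel_act rel_op by (auto simp: letter_ract_def letter_act_def)
  have 2: "frag_of (letter_ract S sop s l, ?m) - frag_of (foldl (letter_ract S sop) (letter_ract S sop s l) w, m) \<in> rel"
    using Cons.IH T.letter_ract_closed[OF l] Cons.prems by blast
  from rel.cong_trans[OF rel.cong_sym[OF 1] 2] show ?case by simp
qed simp

text \<open>This is \<open>a \<otimes> (\<Sum>\<^sub>t u\<^sub>t \<cdot> t) = \<Sum>\<^sub>t (a \<cdot> u\<^sub>t) \<otimes> t\<close>: the letters of a word move one by one through the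
tensor sign.\<close>

lemma rel_word_value:
  assumes s: "s \<in> carrier S" and y: "Poly_Mapping.keys y \<subseteq> L.gens"
  shows "frag_of (s, L.val y) - spread S sop s y \<in> rel"
  using y
proof (rule free_Abelian_group_induct)
  show "frag_of (s, L.val 0) - spread S sop s 0 \<in> rel"
    using rel_zero_right[OF s] by (simp add: spread_zero L.M.hom_free_zero[OF L.word_value_hom])
next
  fix x y
  assume keys: "Poly_Mapping.keys x \<subseteq> L.gens" "Poly_Mapping.keys y \<subseteq> L.gens"
    and "frag_of (s, L.val x) - spread S sop s x \<in> rel" "frag_of (s, L.val y) - spread S sop s y \<in> rel"
  then have "(frag_of (s, L.val x) - spread S sop s x) - (frag_of (s, L.val y) - spread S sop s y) \<in> rel"
    by (blast intro: rel.diff_mem)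
  moreover have "frag_of (s, L.val (x - y)) - (frag_of (s, L.val x) - frag_of (s, L.val y)) \<in> rel"
    using keys s by (simp add: L.word_value_diff rel_diff_right L.word_value_closed)
  ultimately show "frag_of (s, L.val (x - y)) - spread S sop s (x - y) \<in> rel"
    using rel.add_mem by (fastforce simp: spread_diff algebra_simps)
next
  fix g assume "g \<in> L.gens"
  then obtain w m where g: "g = (w, m)" "w \<in> lists (letters R \<Omega>)" "m \<in> carrier M"
    unfolding word_gens_def by blast
  then show "frag_of (s, L.val (frag_of g)) - spread S sop s (frag_of g) \<in> rel"
    using rel_foldr[OF g(2) s g(3)] \<open>g \<in> L.gens\<close> by (simp add: L.word_value_of)
qed

end

section \<open>The tensor functor\<close>

definition shift :: "('s \<Rightarrow> 't) \<Rightarrow> (('s \<times> 'm) \<Rightarrow>\<^sub>0 int) \<Rightarrow> (('t \<times> 'm) \<Rightarrow>\<^sub>0 int)"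
  where "shift f = frag_extend (\<lambda>(s, m). frag_of (f s, m))"

lemma shift_of [simp]: "shift f (frag_of (s, m)) = frag_of (f s, m)"
  by (simp add: shift_def)

lemma shift_diff: "shift f (x - y) = shift f x - shift f y"
  by (simp add: shift_def frag_extend_diff)

lemma shift_zero: "shift f 0 = 0"
  by (simp add: shift_def)

lemma keys_shift:
  "Poly_Mapping.keys x \<subseteq> A \<times> E \<Longrightarrow> f ` A \<subseteq> A' \<Longrightarrow> Poly_Mapping.keys (shift f x) \<subseteq> A' \<times> E"
  unfolding shift_def by (erule keys_frag_extend_subset) auto

lemma mrb_tensor_map_eq: "mrb_tensor_map R \<Omega> S sop M mop f U =
    tensor_relations R \<Omega> S sop M mop <#>\<^bsub>free_Abelian_group (carrier S \<times> carrier M)\<^esub> shift f ` U"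
  by (simp add: mrb_tensor_map_def tensor_generators_def shift_def)

lemma mrb_tensor_eq: "mrb_tensor R \<Omega> S sop M mop =
    free_Abelian_group (carrier S \<times> carrier M) Mod tensor_relations R \<Omega> S sop M mop"
  by (simp add: mrb_tensor_def tensor_generators_def)

lemma right_mrb_homD:
  assumes "h \<in> right_mrb_hom R \<Omega> M mop N nop"
  shows "x \<in> carrier M \<Longrightarrow> h x \<in> carrier N"
    and "x \<in> carrier M \<Longrightarrow> y \<in> carrier M \<Longrightarrow> h (x \<oplus>\<^bsub>M\<^esub> y) = h x \<oplus>\<^bsub>N\<^esub> h y"
    and "r \<in> carrier R \<Longrightarrow> x \<in> carrier M \<Longrightarrow> h (x \<oslash>\<^bsub>M\<^esub> r) = h x \<oslash>\<^bsub>N\<^esub> r"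
    and "\<omega> \<in> \<Omega> \<Longrightarrow> x \<in> carrier M \<Longrightarrow> h (mop \<omega> x) = nop \<omega> (h x)"
  using assms by (auto simp: right_mrb_hom_def hom_def)

locale mrb_pair_hom =
  A: mrb_pair K R \<Omega> lam P M mop A aop + B: mrb_pair K R \<Omega> lam P M mop B bop
  for K :: "('k, 'x) ring_scheme" and R :: "('k, 'r, 'y) module_scheme"
    and \<Omega> :: "'w set" and lam :: "'w \<Rightarrow> 'k" and P :: "'w \<Rightarrow> 'r \<Rightarrow> 'r"
    and M :: "('r, 'm, 'z) module_scheme" and mop :: "'w \<Rightarrow> 'm \<Rightarrow> 'm"
    and A :: "('r, 'a, 'u) rmodule_scheme" and aop :: "'w \<Rightarrow> 'a \<Rightarrow> 'a"
    and B :: "('r, 'b, 'v) rmodule_scheme" and bop :: "'w \<Rightarrow> 'b \<Rightarrow> 'b" +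
  fixes f :: "'a \<Rightarrow> 'b"
  assumes f_hom: "f \<in> right_mrb_hom R \<Omega> A aop B bop"
begin

lemmas f_closed = right_mrb_homD(1)[OF f_hom]
lemmas f_add = right_mrb_homD(2)[OF f_hom]
lemmas f_ract = right_mrb_homD(3)[OF f_hom]
lemmas f_op = right_mrb_homD(4)[OF f_hom]

lemma shift_rel: "shift f ` A.rel \<subseteq> B.rel"
  by (rule A.rel_image_subset[OF B.frag_subgroup_rel shift_diff])
    (simp_all add: f_closed f_add f_ract f_op B.rel_add_left B.rel_add_right B.rel_act B.rel_op)

lemma keys_shift_hom: "Poly_Mapping.keys x \<subseteq> carrier A \<times> carrier M \<Longrightarrow>
    Poly_Mapping.keys (shift f x) \<subseteq> carrier B \<times> carrier M"
  by (erule keys_shift) (auto simp: f_closed)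

lemma mrb_tensor_map_cls:
  "mrb_tensor_map R \<Omega> B bop M mop f (A.rel.cls x) = B.rel.cls (shift f x)"
  unfolding mrb_tensor_map_eq
  by (rule B.rel.induced_cls[OF A.frag_subgroup_rel shift_diff shift_rel])

lemma mrb_tensor_map_hom:
  "group_hom (mrb_tensor R \<Omega> A aop M mop) (mrb_tensor R \<Omega> B bop M mop)
    (mrb_tensor_map R \<Omega> B bop M mop f)"
proof -
  have "group_hom (mrb_tensor R \<Omega> A aop M mop) (mrb_tensor R \<Omega> B bop M mop)
    (\<lambda>U. B.rel <#>\<^bsub>free_Abelian_group (carrier B \<times> carrier M)\<^esub> shift f ` U)"
    unfolding mrb_tensor_eq shift_def
    by (rule quotient_hom[OF A.frag_subgroup_rel B.frag_subgroup_rel])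
      (use shift_rel f_closed in \<open>auto simp: shift_def\<close>)
  then show ?thesis
    by (simp add: mrb_tensor_map_eq[abs_def])
qed

text \<open>Let \<open>e\<close> be the map \<open>(b, x) \<mapsto> spread b (y x)\<close>, for \<open>A\<close> and for \<open>B\<close>. For \<open>B\<close> it sends the relations
  of the tensor product to combinations with zero coordinates, and it commutes with \<open>f\<close>. So if the image
  of \<open>x\<close> under \<open>f\<close> is a relation, the coordinates of \<open>e x\<close> vanish after applying \<open>f\<close>, hence vanish, and
  \<open>e x\<close> is a relation; but \<open>x\<close> and \<open>e x\<close> represent the same tensor.\<close>

lemma mrb_tensor_map_inj:
  assumes proj: "left_mrb_projective TYPE(('r, 'w, 'm) word_universe) K R \<Omega> lam P M mop"
    and inj: "inj_on f (carrier A)"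
  shows "inj_on (mrb_tensor_map R \<Omega> B bop M mop f) (carrier (mrb_tensor R \<Omega> A aop M mop))"
proof -
  let ?DA = "zero_coordinates A (carrier M)" and ?DB = "zero_coordinates B (carrier M)"
  let ?N = "word_kernel R \<Omega> M mop \<inter> spread_kernel R \<Omega> B bop (carrier M)"
  have "word_congruence K R \<Omega> lam P (carrier M) ?N"
    by (intro word_congruence_Int A.L.word_congruence_word_kernel B.T.word_congruence_spread_kernel)
  then obtain y where
    keys_y: "\<And>x. x \<in> carrier M \<Longrightarrow> Poly_Mapping.keys (y x) \<subseteq> word_gens R \<Omega> (carrier M)"
    and val_y: "\<And>x. x \<in> carrier M \<Longrightarrow> word_value R \<Omega> M mop (y x) = x"
    and add_y: "\<And>x x'. x \<in> carrier M \<Longrightarrow> x' \<in> carrier M \<Longrightarrow> y (x \<oplus>\<^bsub>M\<^esub> x') - (y x + y x') \<in> ?N"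
    and act_y: "\<And>r x. r \<in> carrier R \<Longrightarrow> x \<in> carrier M \<Longrightarrow> y (r \<odot>\<^bsub>M\<^esub> x) - prepend (Inl r) (y x) \<in> ?N"
    and op_y: "\<And>\<omega> x. \<omega> \<in> \<Omega> \<Longrightarrow> x \<in> carrier M \<Longrightarrow> y (mop \<omega> x) - prepend (Inr \<omega>) (y x) \<in> ?N"
    using projective_section[OF proj, of ?N] by blast
  interpret DB: frag_subgroup "carrier B \<times> carrier M" ?DB
    by (rule B.T.frag_subgroup_zero_coordinates)
  define eA where "eA = frag_extend (\<lambda>(a, x). spread A aop a (y x))"
  define eB where "eB = frag_extend (\<lambda>(b, x). spread B bop b (y x))"
  have eB_diff: "eB (u - v) = eB u - eB v" for u v
    by (simp add: eB_def frag_extend_diff)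
  have eA_diff: "eA (u - v) = eA u - eA v" for u v
    by (simp add: eA_def frag_extend_diff)
  have spread_N: "spread B bop b x \<in> ?DB" if "b \<in> carrier B" "x \<in> ?N" for b x
    using that by (simp add: spread_kernel_def)
  have eB_rel: "eB ` B.rel \<subseteq> ?DB"
  proof (rule B.rel_image_subset[OF DB.frag_subgroup_axioms eB_diff])
    fix s s' m assume "s \<in> carrier B" "s' \<in> carrier B" "m \<in> carrier M"
    then show "eB (frag_of (s \<oplus>\<^bsub>B\<^esub> s', m)) - (eB (frag_of (s, m)) + eB (frag_of (s', m))) \<in> ?DB"
      by (simp add: eB_def B.T.spread_add_left keys_y)
  next
    fix s m m' assume "s \<in> carrier B" "m \<in> carrier M" "m' \<in> carrier M"
    then show "eB (frag_of (s, m \<oplus>\<^bsub>M\<^esub> m')) - (eB (frag_of (s, m)) + eB (frag_of (s, m'))) \<in> ?DB"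
      using spread_N[OF _ add_y] by (simp add: eB_def spread_diff spread_add)
  next
    fix s r m assume "s \<in> carrier B" "r \<in> carrier R" "m \<in> carrier M"
    then show "eB (frag_of (s \<oslash>\<^bsub>B\<^esub> r, m)) - eB (frag_of (s, r \<odot>\<^bsub>M\<^esub> m)) \<in> ?DB"
      using DB.cong_sym spread_N[OF _ act_y]
      by (simp add: eB_def spread_diff spread_prepend letter_ract_def)
  next
    fix \<omega> s m assume "\<omega> \<in> \<Omega>" "s \<in> carrier B" "m \<in> carrier M"
    then show "eB (frag_of (bop \<omega> s, m)) - eB (frag_of (s, mop \<omega> m)) \<in> ?DB"
      using DB.cong_sym spread_N[OF _ op_y]
      by (simp add: eB_def spread_diff spread_prepend letter_ract_def)
  qed
  have keys_eA: "Poly_Mapping.keys (eA x) \<subseteq> carrier A \<times> carrier M"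
    if "Poly_Mapping.keys x \<subseteq> carrier A \<times> carrier M" for x
    unfolding eA_def using that
    by (rule keys_frag_extend_subset) (auto dest: subsetD[OF A.T.keys_spread[OF _ keys_y]])
  have f_foldl: "f (foldl (letter_ract A aop) a w) = foldl (letter_ract B bop) (f a) w"
    if "w \<in> lists (letters R \<Omega>)" "a \<in> carrier A" for w a
    using that
  proof (induction w arbitrary: a)
    case (Cons l w)
    then have "f (letter_ract A aop a l) = letter_ract B bop (f a) l"
      by (auto simp: letter_ract_def f_ract f_op)
    with Cons show ?case by (simp add: A.T.letter_ract_closed)
  qed simp
  have shift_spread: "shift f (spread A aop a x) = spread B bop (f a) x"
    if "Poly_Mapping.keys x \<subseteq> word_gens R \<Omega> (carrier M)" "a \<in> carrier A" for a x
    using that(1)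
  proof (rule free_Abelian_group_induct)
    fix g assume "g \<in> word_gens R \<Omega> (carrier M)"
    then obtain w m where "g = (w, m)" "w \<in> lists (letters R \<Omega>)"
      unfolding word_gens_def by blast
    then show "shift f (spread A aop a (frag_of g)) = spread B bop (f a) (frag_of g)"
      using f_foldl[OF _ that(2)] by simp
  qed (simp_all add: spread_zero spread_diff shift_zero shift_diff)
  \<comment> \<open>Naturality of the dual basis maps: the same representatives \<open>y x\<close> serve \<open>A\<close> and \<open>B\<close>.\<close>
  have shift_e: "shift f (eA x) = eB (shift f x)"
    if "Poly_Mapping.keys x \<subseteq> carrier A \<times> carrier M" for x
    using that
  proof (rule free_Abelian_group_induct)
    show "shift f (eA 0) = eB (shift f 0)"
      by (simp add: eA_def eB_def shift_zero)
  qed (auto simp: eA_diff eB_diff shift_diff, auto simp: eA_def eB_def shift_spread keys_y)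
  have f_zero: "f \<zero>\<^bsub>A\<^esub> = \<zero>\<^bsub>B\<^esub>"
    using f_add[of "\<zero>\<^bsub>A\<^esub>" "\<zero>\<^bsub>A\<^esub>"] f_closed[of "\<zero>\<^bsub>A\<^esub>"] by simp
  have f_group_hom: "f \<in> hom (add_monoid A) (add_monoid B)"
    using f_hom by (simp add: right_mrb_hom_def)
  \<comment> \<open>The only use of the injectivity of \<open>f\<close>: it detects zero coordinates.\<close>
  have shift_D: "z \<in> ?DA" if z: "Poly_Mapping.keys z \<subseteq> carrier A \<times> carrier M" "shift f z \<in> ?DB" for z
  proof -
    have "coordinate A (carrier M) t z = \<zero>\<^bsub>A\<^esub>" if t: "t \<in> carrier M" for t
    proof -
      have "shift f \<in> hom (free_Abelian_group (carrier A \<times> carrier M)) (free_Abelian_group (carrier B \<times> carrier M))"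
        unfolding shift_def by (rule frag_extend_hom) (auto simp: f_closed)
      then have 1: "coordinate B (carrier M) t \<circ> shift f
          \<in> hom (free_Abelian_group (carrier A \<times> carrier M)) (add_monoid B)"
        by (rule hom_compose[OF _ B.T.coordinate_hom])
      have 2: "f \<circ> coordinate A (carrier M) t \<in> hom (free_Abelian_group (carrier A \<times> carrier M)) (add_monoid B)"
        by (rule hom_compose[OF A.T.coordinate_hom f_group_hom])
      have "(f \<circ> coordinate A (carrier M) t) z = (coordinate B (carrier M) t \<circ> shift f) z"
        by (rule B.T.S.hom_free_eqI[OF 2 1 _ z(1)])
          (auto simp: A.T.coordinate_of B.T.coordinate_of f_closed f_zero)
      also have "\<dots> = \<zero>\<^bsub>B\<^esub>"
        using z(2) t by (simp add: zero_coordinates_def)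
      finally have "f (coordinate A (carrier M) t z) = f \<zero>\<^bsub>A\<^esub>"
        by (simp add: f_zero)
      then show ?thesis
        using inj A.T.coordinate_closed[OF z(1)] by (auto dest: inj_onD)
    qed
    then show ?thesis using z(1) by (simp add: zero_coordinates_def)
  qed
  have rel_eA: "x - eA x \<in> A.rel" if "Poly_Mapping.keys x \<subseteq> carrier A \<times> carrier M" for x
    using that
  proof (rule free_Abelian_group_induct)
    show "0 - eA 0 \<in> A.rel" by (simp add: eA_def)
  next
    fix u v assume "u - eA u \<in> A.rel" "v - eA v \<in> A.rel"
    from A.rel.diff_mem[OF this] show "(u - v) - eA (u - v) \<in> A.rel"
      by (simp add: eA_diff algebra_simps)
  next
    fix g assume "g \<in> carrier A \<times> carrier M"
    then show "frag_of g - eA (frag_of g) \<in> A.rel"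
      using A.rel_word_value[OF _ keys_y] by (auto simp: eA_def val_y)
  qed
  have key: "x \<in> A.rel" if x: "Poly_Mapping.keys x \<subseteq> carrier A \<times> carrier M" "shift f x \<in> B.rel" for x
  proof -
    have "shift f (eA x) \<in> ?DB"
      using eB_rel x by (auto simp: shift_e)
    then have "eA x \<in> A.rel"
      using shift_D[OF keys_eA[OF x(1)]] A.zero_coordinates_subset_rel by blast
    with rel_eA[OF x(1)] show ?thesis by (rule A.rel.cong_mem)
  qed
  show ?thesis
  proof (rule inj_onI)
    fix U V assume "U \<in> carrier (mrb_tensor R \<Omega> A aop M mop)" "V \<in> carrier (mrb_tensor R \<Omega> A aop M mop)"
      and eq: "mrb_tensor_map R \<Omega> B bop M mop f U = mrb_tensor_map R \<Omega> B bop M mop f V"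
    then obtain u v where uv: "U = A.rel.cls u" "V = A.rel.cls v"
      "Poly_Mapping.keys u \<subseteq> carrier A \<times> carrier M" "Poly_Mapping.keys v \<subseteq> carrier A \<times> carrier M"
      by (auto simp: mrb_tensor_eq A.rel.carrier_quotient)
    with eq show "U = V"
      using key[of "u - v"]
      by (simp add: mrb_tensor_map_cls B.rel.cls_eq_iff A.rel.cls_eq_iff shift_diff keys_diff_subset)
  qed
qed

lemma mrb_tensor_map_surj:
  assumes "f ` carrier A = carrier B"
  shows "mrb_tensor_map R \<Omega> B bop M mop f ` carrier (mrb_tensor R \<Omega> A aop M mop)
    = carrier (mrb_tensor R \<Omega> B bop M mop)"
proof -
  have "\<exists>u. Poly_Mapping.keys u \<subseteq> carrier A \<times> carrier M \<and> shift f u = v"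
    if "Poly_Mapping.keys v \<subseteq> carrier B \<times> carrier M" for v
    using that
  proof (rule free_Abelian_group_induct)
    show "\<exists>u. Poly_Mapping.keys u \<subseteq> carrier A \<times> carrier M \<and> shift f u = 0"
      by (intro exI[of _ 0]) (simp add: shift_zero)
  next
    fix x y
    assume "\<exists>u. Poly_Mapping.keys u \<subseteq> carrier A \<times> carrier M \<and> shift f u = x"
      "\<exists>u. Poly_Mapping.keys u \<subseteq> carrier A \<times> carrier M \<and> shift f u = y"
    then show "\<exists>u. Poly_Mapping.keys u \<subseteq> carrier A \<times> carrier M \<and> shift f u = x - y"
      using keys_diff_subset shift_diff by metis
  next
    fix g assume "g \<in> carrier B \<times> carrier M"
    then obtain a m where "g = (f a, m)" "a \<in> carrier A" "m \<in> carrier M"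
      using assms by blast
    then show "\<exists>u. Poly_Mapping.keys u \<subseteq> carrier A \<times> carrier M \<and> shift f u = frag_of g"
      by (intro exI[of _ "frag_of (a, m)"]) simp
  qed
  then have "shift f ` {x. Poly_Mapping.keys x \<subseteq> carrier A \<times> carrier M}
      = {x. Poly_Mapping.keys x \<subseteq> carrier B \<times> carrier M}"
    using keys_shift_hom by (auto simp: image_iff)
  then show ?thesis
    unfolding mrb_tensor_eq A.rel.carrier_quotient B.rel.carrier_quotient image_image mrb_tensor_map_cls
    by (metis image_image)
qed

end

section \<open>Flatness of projective modules\<close>

text \<open>Let \<open>D\<close> consist of the combinations congruent to one in the image of \<open>f\<close>; dividing by it gives the
cokernel of \<open>f \<otimes> M\<close>. Modulo \<open>D\<close> a pair \<open>(b, m)\<close> depends on \<open>g b\<close> and \<open>m\<close> only, so any choice \<open>\<sigma>\<close> of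
preimages under \<open>g\<close>, additive or not, induces a homomorphism from \<open>C \<otimes> M\<close> to the cokernel that is left
inverse to the map induced by \<open>g\<close>.\<close>

lemma mrb_tensor_map_kernel:
  assumes "mrb_pair_hom K R \<Omega> lam P M mop A aop B bop f"
    and "mrb_pair_hom K R \<Omega> lam P M mop B bop C cop g"
    and im: "f ` carrier A = kernel (add_monoid B) (add_monoid C) g"
    and surj: "g ` carrier B = carrier C"
  shows "mrb_tensor_map R \<Omega> B bop M mop f ` carrier (mrb_tensor R \<Omega> A aop M mop)
    = kernel (mrb_tensor R \<Omega> B bop M mop) (mrb_tensor R \<Omega> C cop M mop)
        (mrb_tensor_map R \<Omega> C cop M mop g)"
proof -
  interpret f: mrb_pair_hom K R \<Omega> lam P M mop A aop B bop f by fact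
  interpret g: mrb_pair_hom K R \<Omega> lam P M mop B bop C cop g by fact
  have im_iff: "b \<in> f ` carrier A \<longleftrightarrow> b \<in> carrier B \<and> g b = \<zero>\<^bsub>C\<^esub>" for b
    unfolding im by (simp add: kernel_def)
  define D where "D = {v. Poly_Mapping.keys v \<subseteq> carrier B \<times> carrier M \<and>
    (\<exists>u. Poly_Mapping.keys u \<subseteq> carrier A \<times> carrier M \<and> v - shift f u \<in> f.B.rel)}"
  interpret D: frag_subgroup "carrier B \<times> carrier M" D
  proof
    show "0 \<in> D"
      unfolding D_def by (auto intro!: exI[of _ 0] simp: shift_zero)
    fix x y assume "x \<in> D" "y \<in> D"
    then obtain u v where uv: "Poly_Mapping.keys u \<subseteq> carrier A \<times> carrier M" "x - shift f u \<in> f.B.rel"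
      "Poly_Mapping.keys v \<subseteq> carrier A \<times> carrier M" "y - shift f v \<in> f.B.rel"
      "Poly_Mapping.keys x \<subseteq> carrier B \<times> carrier M" "Poly_Mapping.keys y \<subseteq> carrier B \<times> carrier M"
      by (auto simp: D_def)
    then have "(x - y) - shift f (u - v) \<in> f.B.rel"
      using f.B.rel.diff_mem[of "x - shift f u" "y - shift f v"] by (simp add: shift_diff algebra_simps)
    with uv show "x - y \<in> D"
      unfolding D_def by (intro CollectI conjI exI[of _ "u - v"]) (simp_all add: keys_diff_subset)
  qed (simp add: D_def)
  have rel_D: "x \<in> D" if "x \<in> f.B.rel" for x
    using that f.B.rel.keys_mem by (auto simp: D_def shift_zero intro!: exI[of _ 0])
  \<comment> \<open>Exactness at \<open>B\<close> enters here: \<open>b \<ominus> b'\<close> is in the image of \<open>f\<close>.\<close>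
  have fibre: "frag_of (b, m) - frag_of (b', m) \<in> D"
    if b: "b \<in> carrier B" "b' \<in> carrier B" "m \<in> carrier M" "g b = g b'" for b b' m
  proof -
    have d: "b \<ominus>\<^bsub>B\<^esub> b' \<in> carrier B" using b by simp
    have "(b \<ominus>\<^bsub>B\<^esub> b') \<oplus>\<^bsub>B\<^esub> b' = b"
      using b by (simp add: f.B.T.S.minus_eq f.B.T.S.a_assoc f.B.T.S.l_neg)
    then have "g (b \<ominus>\<^bsub>B\<^esub> b') \<oplus>\<^bsub>C\<^esub> g b' = g b'"
      using g.f_add[OF d b(2)] b(4) by simp
    then have "g (b \<ominus>\<^bsub>B\<^esub> b') = \<zero>\<^bsub>C\<^esub>"
      using g.f_closed[OF d] g.f_closed[OF b(2)] by simp
    then obtain a where a: "a \<in> carrier A" "b \<ominus>\<^bsub>B\<^esub> b' = f a"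
      using d im_iff[of "b \<ominus>\<^bsub>B\<^esub> b'"] by auto
    have "(frag_of (b, m) - frag_of (b', m)) - shift f (frag_of (a, m)) \<in> f.B.rel"
      using f.B.rel.uminus_mem[OF f.B.rel_diff_left[OF b(1-3)]] a by (simp add: algebra_simps)
    then show ?thesis
      using a b by (auto simp: D_def keys_diff_subset intro!: exI[of _ "frag_of (a, m)"])
  qed
  define \<sigma> where "\<sigma> = inv_into (carrier B) g"
  have \<sigma>: "\<sigma> c \<in> carrier B" "g (\<sigma> c) = c" if "c \<in> carrier C" for c
    using that surj by (auto simp: \<sigma>_def inv_into_into f_inv_into_f)
  have \<sigma>_rel: "shift \<sigma> ` g.B.rel \<subseteq> D"
  proof (rule g.B.rel_image_subset[OF D.frag_subgroup_axioms shift_diff])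
    fix s s' m assume s: "s \<in> carrier C" "s' \<in> carrier C" "m \<in> carrier M"
    have "frag_of (\<sigma> (s \<oplus>\<^bsub>C\<^esub> s'), m) - frag_of (\<sigma> s \<oplus>\<^bsub>B\<^esub> \<sigma> s', m) \<in> D"
      by (rule fibre) (use s \<sigma> in \<open>simp_all add: g.f_add\<close>)
    moreover have "frag_of (\<sigma> s \<oplus>\<^bsub>B\<^esub> \<sigma> s', m) - (frag_of (\<sigma> s, m) + frag_of (\<sigma> s', m)) \<in> D"
      using s \<sigma> by (intro rel_D f.B.rel_add_left)
    ultimately show "shift \<sigma> (frag_of (s \<oplus>\<^bsub>C\<^esub> s', m))
        - (shift \<sigma> (frag_of (s, m)) + shift \<sigma> (frag_of (s', m))) \<in> D"
      unfolding shift_of by (rule D.cong_trans)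
  next
    fix s m m' assume "s \<in> carrier C" "m \<in> carrier M" "m' \<in> carrier M"
    then show "shift \<sigma> (frag_of (s, m \<oplus>\<^bsub>M\<^esub> m'))
        - (shift \<sigma> (frag_of (s, m)) + shift \<sigma> (frag_of (s, m'))) \<in> D"
      using \<sigma> by (simp add: rel_D f.B.rel_add_right)
  next
    fix s r m assume s: "s \<in> carrier C" "r \<in> carrier R" "m \<in> carrier M"
    have "frag_of (\<sigma> (s \<oslash>\<^bsub>C\<^esub> r), m) - frag_of (\<sigma> s \<oslash>\<^bsub>B\<^esub> r, m) \<in> D"
      by (rule fibre) (use s \<sigma> in \<open>simp_all add: g.f_ract g.B.T.ract_closed f.B.T.ract_closed\<close>)
    moreover have "frag_of (\<sigma> s \<oslash>\<^bsub>B\<^esub> r, m) - frag_of (\<sigma> s, r \<odot>\<^bsub>M\<^esub> m) \<in> D"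
      using s \<sigma> by (intro rel_D f.B.rel_act)
    ultimately show "shift \<sigma> (frag_of (s \<oslash>\<^bsub>C\<^esub> r, m)) - shift \<sigma> (frag_of (s, r \<odot>\<^bsub>M\<^esub> m)) \<in> D"
      unfolding shift_of by (rule D.cong_trans)
  next
    fix \<omega> s m assume s: "\<omega> \<in> \<Omega>" "s \<in> carrier C" "m \<in> carrier M"
    have "frag_of (\<sigma> (cop \<omega> s), m) - frag_of (bop \<omega> (\<sigma> s), m) \<in> D"
      by (rule fibre) (use s \<sigma> in \<open>simp_all add: g.f_op g.B.T.sop_closed f.B.T.sop_closed\<close>)
    moreover have "frag_of (bop \<omega> (\<sigma> s), m) - frag_of (\<sigma> s, mop \<omega> m) \<in> D"
      using s \<sigma> by (intro rel_D f.B.rel_op)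
    ultimately show "shift \<sigma> (frag_of (cop \<omega> s, m)) - shift \<sigma> (frag_of (s, mop \<omega> m)) \<in> D"
      unfolding shift_of by (rule D.cong_trans)
  qed
  have \<sigma>_g: "v - shift \<sigma> (shift g v) \<in> D" if "Poly_Mapping.keys v \<subseteq> carrier B \<times> carrier M" for v
    using that
  proof (rule free_Abelian_group_induct)
    show "0 - shift \<sigma> (shift g 0) \<in> D" by (simp add: shift_zero)
  next
    fix x y assume "x - shift \<sigma> (shift g x) \<in> D" "y - shift \<sigma> (shift g y) \<in> D"
    from D.diff_mem[OF this] show "(x - y) - shift \<sigma> (shift g (x - y)) \<in> D"
      by (simp add: shift_diff algebra_simps)
  next
    fix h assume "h \<in> carrier B \<times> carrier M"
    then show "frag_of h - shift \<sigma> (shift g (frag_of h)) \<in> D"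
      using fibre \<sigma> g.f_closed by auto
  qed
  have gf: "shift g (shift f u) \<in> g.B.rel" if "Poly_Mapping.keys u \<subseteq> carrier A \<times> carrier M" for u
    using that
  proof (rule free_Abelian_group_induct)
    fix h assume "h \<in> carrier A \<times> carrier M"
    then show "shift g (shift f (frag_of h)) \<in> g.B.rel"
      using im_iff[of "f (fst h)"] g.B.rel_zero_left by auto
  qed (simp_all add: shift_zero shift_diff g.B.rel.diff_mem)
  have one: "\<one>\<^bsub>mrb_tensor R \<Omega> C cop M mop\<^esub> = g.B.rel.cls 0"
    by (simp add: mrb_tensor_eq g.B.rel.one_quotient g.B.rel.cls_zero)
  show ?thesis
  proof (intro equalityI subsetI)
    fix V assume "V \<in> mrb_tensor_map R \<Omega> B bop M mop f ` carrier (mrb_tensor R \<Omega> A aop M mop)"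
    then obtain u where u: "Poly_Mapping.keys u \<subseteq> carrier A \<times> carrier M" "V = f.B.rel.cls (shift f u)"
      by (auto simp: mrb_tensor_eq f.A.rel.carrier_quotient f.mrb_tensor_map_cls)
    then show "V \<in> kernel (mrb_tensor R \<Omega> B bop M mop) (mrb_tensor R \<Omega> C cop M mop)
        (mrb_tensor_map R \<Omega> C cop M mop g)"
      using gf[OF u(1)] f.keys_shift_hom[OF u(1)]
      by (simp add: kernel_def one g.mrb_tensor_map_cls g.B.rel.cls_eq_iff)
        (auto simp: mrb_tensor_eq f.B.rel.carrier_quotient)
  next
    fix V assume "V \<in> kernel (mrb_tensor R \<Omega> B bop M mop) (mrb_tensor R \<Omega> C cop M mop)
        (mrb_tensor_map R \<Omega> C cop M mop g)"
    then obtain v where v: "Poly_Mapping.keys v \<subseteq> carrier B \<times> carrier M" "V = f.B.rel.cls v"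
      and "mrb_tensor_map R \<Omega> C cop M mop g V = g.B.rel.cls 0"
      by (auto simp: kernel_def one) (auto simp: mrb_tensor_eq f.B.rel.carrier_quotient)
    then have "shift g v \<in> g.B.rel"
      by (simp add: g.mrb_tensor_map_cls g.B.rel.cls_eq_iff)
    then have "v \<in> D"
      using D.cong_mem[OF \<sigma>_g[OF v(1)]] \<sigma>_rel by blast
    then obtain u where "Poly_Mapping.keys u \<subseteq> carrier A \<times> carrier M" "v - shift f u \<in> f.B.rel"
      by (auto simp: D_def)
    then have "V = mrb_tensor_map R \<Omega> B bop M mop f (f.A.rel.cls u)"
      "f.A.rel.cls u \<in> carrier (mrb_tensor R \<Omega> A aop M mop)"
      by (auto simp: v(2) f.mrb_tensor_map_cls f.B.rel.cls_eq_iff mrb_tensor_eq f.A.rel.carrier_quotient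
          simp del: set_eq_iff)
    then show "V \<in> mrb_tensor_map R \<Omega> B bop M mop f ` carrier (mrb_tensor R \<Omega> A aop M mop)"
      by blast
  qed
qed

theorem theorem4p13:
  fixes K :: "'k ring" and R :: "('k, 'r) module" and \<Omega> :: "'w set" and lam :: "'w \<Rightarrow> 'k"
    and P :: "'w \<Rightarrow> 'r \<Rightarrow> 'r" and S :: "('r, 's) module" and sop :: "'w \<Rightarrow> 's \<Rightarrow> 's"
  assumes "mrb_algebra K R \<Omega> lam P"
    and "left_mrb_module K R \<Omega> lam P S sop"
    and "left_mrb_projective TYPE(('r, 'w, 's) word_universe) K R \<Omega> lam P S sop"
  shows "left_mrb_flat TYPE('a) TYPE('b) TYPE('c) K R \<Omega> lam P S sop"
  unfolding left_mrb_flat_def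
proof (intro conjI allI impI)
  show "left_mrb_module K R \<Omega> lam P S sop" by fact
  fix A :: "('r, 'a) rmodule" and aop and B :: "('r, 'b) rmodule" and bop
    and C :: "('r, 'c) rmodule" and cop f g
  assume mods: "right_mrb_module K R \<Omega> lam P A aop" "right_mrb_module K R \<Omega> lam P B bop"
      "right_mrb_module K R \<Omega> lam P C cop"
    and homs: "f \<in> right_mrb_hom R \<Omega> A aop B bop" "g \<in> right_mrb_hom R \<Omega> B bop C cop"
    and exact: "short_exact (add_monoid A) (add_monoid B) (add_monoid C) f g"
  have f: "mrb_pair_hom K R \<Omega> lam P S sop A aop B bop f"
    and g: "mrb_pair_hom K R \<Omega> lam P S sop B bop C cop g"
    using mods homs assms(2)
    by (simp_all add: mrb_pair_hom_def mrb_pair_hom_axioms_def mrb_pair_def)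
  have inj: "inj_on f (carrier A)" and im: "f ` carrier A = kernel (add_monoid B) (add_monoid C) g"
    and surj: "g ` carrier B = carrier C"
    using exact by (simp_all add: short_exact_def)
  show "short_exact (mrb_tensor R \<Omega> A aop S sop) (mrb_tensor R \<Omega> B bop S sop)
      (mrb_tensor R \<Omega> C cop S sop)
      (mrb_tensor_map R \<Omega> B bop S sop f) (mrb_tensor_map R \<Omega> C cop S sop g)"
    unfolding short_exact_def
    using mrb_pair_hom.mrb_tensor_map_hom[OF f] mrb_pair_hom.mrb_tensor_map_hom[OF g]
      mrb_pair_hom.mrb_tensor_map_inj[OF f assms(3) inj]
      mrb_tensor_map_kernel[OF f g im surj] mrb_pair_hom.mrb_tensor_map_surj[OF g surj]
    by blast
qed

end
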